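(* Let $p$ be a prime and let $z\in\mathbb{C}_p$ with $|1-z|_p\geq 1$. For $k\geq 1$ let $\mu_{k,z}=\mu_{\beta,k,z}$ be the $k$-th twisted Bernoulli measure on $\mathbb{Z}_p$, and write $\beta_k(y)=\beta_k(0,y)$. Then for every integer $k\geq 1$: i) $\displaystyle k\int_{\mathbb{Z}_p} x^{k-1}\,d\mu_{1,z} = \int_{\mathbb{Z}_p} 1\,d\mu_{k,z} = \beta_k(z)$; ii) $\displaystyle k\int_{\mathbb{Z}_p^*} x^{k-1}\,d\mu_{1,z} = \int_{\mathbb{Z}_p^*} 1\,d\mu_{k,z} = \beta_k(z)-p^{k-1}\beta_k(z^p)$; iii) $\displaystyle \int_{\mathbb{Z}_p} x^{r}\,d\mu_{k,z} = k\int_{\mathbb{Z}_p} x^{r+k-1}\,d\mu_{1,z}$ for every integer $r\geq 0$; iv) $\displaystyle \int_{\mathbb{Z}_p^*} x^{r}\,d\mu_{k,z} = k\int_{\mathbb{Z}_p^*} x^{r+k-1}\,d\mu_{1,z}$ for every integer $r$.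
   Context: Twisted Bernoulli polynomials $\beta_k(x,y)\in\mathbb{Z}[y,1/(y-1)][x]$ are defined for $y\ne1$ by $\dfrac{t e^{xt}}{y e^t-1}=\sum_{k=0}^\infty \dfrac{\beta_k(x,y)}{k!}t^k$. $\mathbb{C}_p$ is the completion of a fixed algebraic closure of $\mathbb{Q}_p$, with norm normalized by $|p|_p=1/p$, and $(p^N)=p^N\mathbb{Z}_p$. For $z\in\mathbb{C}_p$ with $|z-1|_p\ge1$, the $k$-th twisted Bernoulli measure is the bounded finitely additive $\mathbb{C}_p$-valued function on compact open subsets of $\mathbb{Z}_p$ given by $\mu_{\beta,k,z}(a+(p^N))=p^{N(k-1)}z^a\beta_k(a/p^N,z^{p^N})$ for $0\le a\le p^N-1$ (convention $0^0=1$). For a measure $\mu$ and continuous $g$, $\int_{\mathbb{Z}_p} g\,d\mu=\lim_{N\to\infty}\sum_{a=0}^{p^N-1} g(a)\mu(a+(p^N))$, and $\int_{\mathbb{Z}_p^*}g\,d\mu$ is the analogous limit with the sum restricted to $a$ with $p\nmid a$. *)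

theory Defs
  imports "HOL-Analysis.Analysis" "HOL-Computational_Algebra.Computational_Algebra"
    "HOL-Library.FuncSet"
begin

text \<open>
  The field \<open>\<complex>\<^sub>p\<close> is represented by an arbitrary type that is a model of it: a field with a
  complete metric coming from a non-archimedean multiplicative norm with \<open>|p| = 1/p\<close>, in which
  the elements algebraic over \<open>\<rat>\<^sub>p\<close> form an algebraic closure of \<open>\<rat>\<^sub>p\<close> and are dense.
  Since the space is complete, the closures of \<open>\<rat>\<close> and of \<open>\<int>\<close> in it are \<open>\<rat>\<^sub>p\<close> and \<open>\<int>\<^sub>p\<close>.
\<close>

definition padic_numbers :: "'a::{field_char_0, complete_space} set" where
  "padic_numbers = closure \<rat>"

definition padic_integers :: "'a::{field_char_0, complete_space} set" where
  "padic_integers = closure \<int>"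

definition padic_algebraic :: "'a::{field_char_0, complete_space} set" where
  "padic_algebraic =
     {x. \<exists>q. q \<noteq> 0 \<and> set (coeffs q) \<subseteq> padic_numbers \<and> poly q x = 0}"

locale padic_complex_numbers =
  fixes p :: nat and nrm :: "'a::{field_char_0, complete_space} \<Rightarrow> real"
  assumes dist_nrm: "dist x y = nrm (x - y)"
    and nrm_mult: "nrm (x * y) = nrm x * nrm y"
    and nrm_ultrametric: "nrm (x + y) \<le> max (nrm x) (nrm y)"
    and nrm_p: "nrm (of_nat p) = 1 / real p"
    and algebraic_closed: "\<And>q :: 'a poly. set (coeffs q) \<subseteq> padic_algebraic \<Longrightarrow> degree q > 0 \<Longrightarrow>
          \<exists>x \<in> padic_algebraic. poly q x = 0"
    and algebraic_dense: "closure (padic_algebraic :: 'a set) = UNIV"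

text \<open>For \<open>y \<noteq> 1\<close> the denominator has the nonzero constant term \<open>y - 1\<close>, so it is a unit.\<close>

definition twisted_bernoulli :: "nat \<Rightarrow> 'a::field_char_0 \<Rightarrow> 'a \<Rightarrow> 'a" where
  "twisted_bernoulli k x y =
     fact k * fps_nth (fps_X * fps_exp x / (fps_const y * fps_exp 1 - 1)) k"

definition compact_opens :: "'a::{field_char_0, complete_space} set set" where
  "compact_opens = {U. compact U \<and> openin (top_of_set padic_integers) U}"

definition padic_measure :: "('a::{field_char_0, complete_space} set \<Rightarrow> 'a) \<Rightarrow> bool" where
  "padic_measure \<mu> \<longleftrightarrow>
     (\<forall>U \<in> compact_opens. \<forall>V \<in> compact_opens. U \<inter> V = {} \<longrightarrow> \<mu> (U \<union> V) = \<mu> U + \<mu> V) \<and>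
     bounded (\<mu> ` compact_opens)"

definition padic_coset :: "nat \<Rightarrow> nat \<Rightarrow> nat \<Rightarrow> 'a::{field_char_0, complete_space} set" where
  "padic_coset p a N = (\<lambda>x. of_nat a + of_nat p ^ N * x) ` padic_integers"

text \<open>
  Only used for \<open>k \<ge> 1\<close>, so that \<open>k - 1\<close> is not truncated.  Extensionality makes the function
  on compact open sets unique as a total function.
\<close>

definition twisted_bernoulli_measure ::
    "nat \<Rightarrow> nat \<Rightarrow> 'a::{field_char_0, complete_space} \<Rightarrow> 'a set \<Rightarrow> 'a" where
  "twisted_bernoulli_measure p k z =
     (THE \<mu>. \<mu> \<in> extensional compact_opens \<and> padic_measure \<mu> \<and>
        (\<forall>N. \<forall>a < p ^ N. \<mu> (padic_coset p a N) =
           of_nat p ^ (N * (k - 1)) * z ^ a *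
           twisted_bernoulli k (of_nat a / of_nat p ^ N) (z ^ (p ^ N))))"

definition riemann_sum_Zp ::
    "nat \<Rightarrow> ('a::{field_char_0, complete_space} set \<Rightarrow> 'a) \<Rightarrow> ('a \<Rightarrow> 'a) \<Rightarrow> nat \<Rightarrow> 'a" where
  "riemann_sum_Zp p \<mu> g N = (\<Sum>a<p ^ N. g (of_nat a) * \<mu> (padic_coset p a N))"

definition riemann_sum_Zp_units ::
    "nat \<Rightarrow> ('a::{field_char_0, complete_space} set \<Rightarrow> 'a) \<Rightarrow> ('a \<Rightarrow> 'a) \<Rightarrow> nat \<Rightarrow> 'a" where
  "riemann_sum_Zp_units p \<mu> g N =
     (\<Sum>a | a < p ^ N \<and> \<not> p dvd a. g (of_nat a) * \<mu> (padic_coset p a N))"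

definition integrable_Zp ::
    "nat \<Rightarrow> ('a::{field_char_0, complete_space} set \<Rightarrow> 'a) \<Rightarrow> ('a \<Rightarrow> 'a) \<Rightarrow> bool" where
  "integrable_Zp p \<mu> g \<longleftrightarrow> convergent (riemann_sum_Zp p \<mu> g)"

definition integral_Zp ::
    "nat \<Rightarrow> ('a::{field_char_0, complete_space} set \<Rightarrow> 'a) \<Rightarrow> ('a \<Rightarrow> 'a) \<Rightarrow> 'a" where
  "integral_Zp p \<mu> g = lim (riemann_sum_Zp p \<mu> g)"

definition integrable_Zp_units ::
    "nat \<Rightarrow> ('a::{field_char_0, complete_space} set \<Rightarrow> 'a) \<Rightarrow> ('a \<Rightarrow> 'a) \<Rightarrow> bool" where
  "integrable_Zp_units p \<mu> g \<longleftrightarrow> convergent (riemann_sum_Zp_units p \<mu> g)"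

definition integral_Zp_units ::
    "nat \<Rightarrow> ('a::{field_char_0, complete_space} set \<Rightarrow> 'a) \<Rightarrow> ('a \<Rightarrow> 'a) \<Rightarrow> 'a" where
  "integral_Zp_units p \<mu> g = lim (riemann_sum_Zp_units p \<mu> g)"

end

theory Submission imports Defs begin

text \<open>
  Put \<open>q = p\<^sup>N\<close> and let \<open>W = z e\<^sup>t\<close> be a formal power series in \<open>t\<close>.  Substituting \<open>q t\<close> for \<open>t\<close> in
  the series that defines the twisted Bernoulli polynomials gives
  \<open>q\<^sup>k\<^sup>-\<^sup>1 z\<^sup>a \<beta>\<^sub>k(a/q, z\<^sup>q) = k! [t\<^sup>k] (t W\<^sup>a / (W\<^sup>q - 1))\<close>,
  and two facts about this value of the \<open>k\<close>-th measure on \<open>a + (q)\<close> carry everything.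

  Additivity is a geometric series: summing \<open>W\<^sup>b / (W\<^sup>q\<^sup>L - 1)\<close> over \<open>b = a + q j\<close>, \<open>j < L\<close>, gives
  \<open>W\<^sup>a / (W\<^sup>q - 1)\<close> (\<open>twisted_bernoulli_multiplication\<close>).  In particular the total mass is
  \<open>\<beta>\<^sub>k(z)\<close>.  A residue \<open>a = p b\<close> turns the pair \<open>z, p\<^sup>N\<close> into \<open>z\<^sup>p, p\<^sup>N\<^sup>-\<^sup>1\<close> at the cost of a
  factor \<open>p\<^sup>k\<^sup>-\<^sup>1\<close>, so the multiples of \<open>p\<close> have mass \<open>p\<^sup>k\<^sup>-\<^sup>1 \<beta>\<^sub>k(z\<^sup>p)\<close>.

  The congruence \<open>\<mu>\<^sub>k(a + (q)) \<equiv> k a\<^sup>k\<^sup>-\<^sup>1 \<mu>\<^sub>1(a + (q))\<close> modulo \<open>q\<close> comes from expanding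
  \<open>\<beta>\<^sub>k(a/q, y)\<close> in powers of \<open>a/q\<close>: since \<open>\<beta>\<^sub>0 = 0\<close>, the highest power of \<open>a/q\<close> is the
  \<open>(k-1)\<close>-st, and every lower one keeps a factor \<open>q\<close>
  (\<open>twisted_bernoulli_distribution_congruence\<close>).  For this the other factors
  \<open>z\<^sup>a \<beta>\<^sub>i(0, z\<^sup>q)\<close> must be integral.  The recurrence for \<open>\<beta>\<^sub>i\<close> gives
  \<open>\<bar>\<beta>\<^sub>i(0, y)\<bar> \<le> 1 / \<bar>y - 1\<bar>\<close> when \<open>\<bar>y - 1\<bar> \<ge> 1\<close>, and \<open>\<bar>z - 1\<bar> \<ge> 1\<close> implies
  \<open>\<bar>z\<^sup>q - 1\<bar> \<ge> \<bar>z\<bar>\<^sup>a\<close> for \<open>a \<le> q\<close>.  Multiplying by \<open>x\<^sup>r\<close> and summing over residues, the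
  Riemann sums for \<open>x\<^sup>r d\<mu>\<^sub>k\<close> and for \<open>k x\<^sup>r\<^sup>+\<^sup>k\<^sup>-\<^sup>1 d\<mu>\<^sub>1\<close> differ by at most \<open>p\<^sup>-\<^sup>N\<close>.

  That the measures exist and are determined by their values on residue classes is a statement
  about arbitrary compatible bounded values (\<open>ex1_measure_of_distribution\<close>): by compactness a
  compact open set is a union of residue classes modulo some \<open>p\<^sup>N\<close>.
\<close>

section \<open>Generating functions\<close>

lemma twisted_bernoulli_eq_nth:
  fixes y :: "'a::field_char_0"
  assumes "y \<noteq> 1"
  shows "twisted_bernoulli k x y =
    fact k * fps_nth (fps_X * fps_exp x * inverse (fps_const y * fps_exp 1 - 1)) k"
  using assms by (simp add: twisted_bernoulli_def fps_divide_unit)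

lemma twisted_bernoulli_zero:
  fixes y :: "'a::field_char_0"
  assumes "y \<noteq> 1"
  shows "twisted_bernoulli 0 x y = 0"
  using assms by (simp add: twisted_bernoulli_eq_nth)

text \<open>
  The variable \<open>x\<close> enters the generating function only through the factor \<open>e\<^sup>x\<^sup>t\<close>, so this is
  the Cauchy product with the series for \<open>x = 0\<close>.
\<close>

lemma twisted_bernoulli_appell:
  fixes y :: "'a::field_char_0"
  assumes "y \<noteq> 1"
  shows "twisted_bernoulli k x y =
    (\<Sum>j\<le>k. of_nat (k choose j) * x ^ j * twisted_bernoulli (k - j) 0 y)"
proof -
  define B where "B = fps_X * inverse (fps_const y * fps_exp 1 - 1)"
  have "twisted_bernoulli k x y = fact k * fps_nth (fps_exp x * B) k"
    using assms by (simp add: twisted_bernoulli_eq_nth B_def mult_ac)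
  also have "\<dots> = (\<Sum>j\<le>k. fact k * (x ^ j / fact j * fps_nth B (k - j)))"
    by (simp add: fps_mult_nth sum_distrib_left atMost_atLeast0)
  also have "\<dots> = (\<Sum>j\<le>k. of_nat (k choose j) * x ^ j * twisted_bernoulli (k - j) 0 y)"
  proof (rule sum.cong[OF refl])
    fix j assume j: "j \<in> {..k}"
    have "twisted_bernoulli (k - j) 0 y = fact (k - j) * fps_nth B (k - j)"
      using assms by (simp add: twisted_bernoulli_eq_nth B_def)
    then show "fact k * (x ^ j / fact j * fps_nth B (k - j)) =
        of_nat (k choose j) * x ^ j * twisted_bernoulli (k - j) 0 y"
      using j by (simp add: binomial_fact field_simps)
  qed
  finally show ?thesis .
qed

text \<open>
  Multiply the generating function by its denominator \<open>y e\<^sup>t - 1\<close>: what remains is \<open>t\<close>.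
\<close>

lemma twisted_bernoulli_difference:
  fixes y :: "'a::field_char_0"
  assumes "y \<noteq> 1"
  shows "y * twisted_bernoulli k 1 y - twisted_bernoulli k 0 y = (if k = 1 then 1 else 0)"
proof -
  define D where "D = fps_const y * fps_exp 1 - 1"
  have D: "D * inverse D = 1"
    using assms by (subst mult.commute, intro inverse_mult_eq_1) (simp add: D_def)
  have "fps_const y * (fps_X * fps_exp 1 * inverse D) - fps_X * inverse D = fps_X * (D * inverse D)"
    by (simp add: D_def algebra_simps)
  then have "fps_nth (fps_const y * (fps_X * fps_exp 1 * inverse D) - fps_X * inverse D) k
      = fps_nth fps_X k" by (simp add: D)
  then have "y * fps_nth (fps_X * fps_exp 1 * inverse D) k - fps_nth (fps_X * inverse D) k
      = (if k = 1 then 1 else 0)" by (simp only: fps_sub_nth fps_mult_left_const_nth fps_X_nth)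
  moreover have "y * twisted_bernoulli k 1 y - twisted_bernoulli k 0 y
     = fact k * (y * fps_nth (fps_X * fps_exp 1 * inverse D) k - fps_nth (fps_X * inverse D) k)"
    using assms by (simp add: twisted_bernoulli_eq_nth D_def algebra_simps)
  ultimately show ?thesis by simp
qed

text \<open>
  Solved for \<open>\<beta>\<^sub>k(0, y)\<close> in terms of lower indices, this controls denominators: each step costs
  only a factor \<open>y / (y - 1)\<close>.
\<close>

lemma twisted_bernoulli_recurrence:
  fixes y :: "'a::field_char_0"
  assumes "y \<noteq> 1"
  shows "(y - 1) * twisted_bernoulli k 0 y = (if k = 1 then 1 else 0)
     - y * (\<Sum>j\<in>{1..k}. of_nat (k choose j) * twisted_bernoulli (k - j) 0 y)"
proof -
  have "{..k} = insert 0 {1..k}" by auto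
  then have "twisted_bernoulli k 1 y = twisted_bernoulli k 0 y +
      (\<Sum>j\<in>{1..k}. of_nat (k choose j) * twisted_bernoulli (k - j) 0 y)"
    using twisted_bernoulli_appell[OF assms, of k 1] by simp
  then show ?thesis
    using twisted_bernoulli_difference[OF assms, of k] by (simp add: algebra_simps)
qed

definition twisted_exp :: "'a::field_char_0 \<Rightarrow> 'a fps" where
  "twisted_exp z = fps_const z * fps_exp 1"

lemma twisted_exp_power: "twisted_exp z ^ n = fps_const (z ^ n) * fps_exp (of_nat n)"
  by (simp add: twisted_exp_def power_mult_distrib fps_exp_power_mult)

text \<open>
  The substitution \<open>t \<mapsto> q t\<close> multiplies the \<open>k\<close>-th coefficient by \<open>q\<^sup>k\<close>, turns \<open>e\<^sup>(\<^sup>a\<^sup>/\<^sup>q\<^sup>)\<^sup>t\<close> into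
  \<open>e\<^sup>a\<^sup>t\<close> and \<open>z\<^sup>q e\<^sup>t\<close> into the \<open>q\<close>-th power of \<open>z e\<^sup>t\<close>.  One factor \<open>q\<close> is lost to the numerator
  \<open>t\<close>.
\<close>

lemma scaled_twisted_bernoulli_eq_nth:
  fixes z :: "'a::field_char_0"
  assumes "z ^ q \<noteq> 1" "q > 0" "k \<ge> 1"
  shows "of_nat q ^ (k - 1) * z ^ a * twisted_bernoulli k (of_nat a / of_nat q) (z ^ q) =
    fact k * fps_nth (fps_X * twisted_exp z ^ a * inverse (twisted_exp z ^ q - 1)) k"
proof -
  define c :: 'a where "c = of_nat q"
  define D where "D = fps_const (z ^ q) * fps_exp 1 - 1"
  define F where "F = fps_X * fps_exp (of_nat a / c) * inverse D"
  define G where "G = fps_X * fps_exp (of_nat a) * inverse (twisted_exp z ^ q - 1)"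
  have c: "c \<noteq> 0" using assms(2) by (simp add: c_def)
  have "fps_nth (fps_const c * fps_X) 0 = 0" by simp
  note distrib = fps_compose_mult_distrib[OF this] fps_compose_sub_distrib
  have D0: "fps_nth D 0 \<noteq> 0" using assms(1) by (simp add: D_def)
  have "D oo (fps_const c * fps_X) = twisted_exp z ^ q - 1"
    by (simp add: D_def distrib twisted_exp_power fps_exp_compose_linear flip: c_def)
  then have "F oo (fps_const c * fps_X) = fps_const c * G"
    using c D0 by (simp add: F_def G_def distrib fps_inverse_compose fps_exp_compose_linear)
  then have "fps_nth (F oo (fps_const c * fps_X)) k = c * fps_nth G k" by simp
  then have "c ^ k * fps_nth F k = c * fps_nth G k" by (simp add: fps_compose_linear)
  moreover have "c ^ k = c * c ^ (k - 1)" using assms(3) by (metis Suc_pred' less_eq_Suc_le One_nat_def power_Suc)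
  ultimately have "c ^ (k - 1) * fps_nth F k = fps_nth G k" using c by simp
  moreover have "fps_nth (fps_X * twisted_exp z ^ a * inverse (twisted_exp z ^ q - 1)) k = z ^ a * fps_nth G k"
  proof -
    have "fps_X * twisted_exp z ^ a * inverse (twisted_exp z ^ q - 1) = fps_const (z ^ a) * G"
      by (simp add: G_def twisted_exp_power[of z a] mult_ac)
    then show ?thesis by simp
  qed
  moreover have "twisted_bernoulli k (of_nat a / of_nat q) (z ^ q) = fact k * fps_nth F k"
    using assms(1) by (simp add: twisted_bernoulli_eq_nth F_def D_def c_def)
  moreover have "c ^ (k - 1) * z ^ a * (fact k * fps_nth F k) =
      fact k * (z ^ a * (c ^ (k - 1) * fps_nth F k))" by (simp only: mult_ac)
  ultimately show ?thesis by (simp only: c_def)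
qed

text \<open>
  With \<open>V = (z e\<^sup>t)\<^sup>q\<close> this is the geometric series \<open>\<Sum>j<L. V\<^sup>j = (V\<^sup>L - 1) / (V - 1)\<close>.
\<close>

lemma twisted_bernoulli_multiplication:
  fixes z :: "'a::field_char_0"
  assumes "z ^ q \<noteq> 1" "z ^ (q * L) \<noteq> 1" "q > 0" "L > 0" "k \<ge> 1"
  shows "(\<Sum>j<L. of_nat (q * L) ^ (k - 1) * z ^ (a + q * j) *
            twisted_bernoulli k (of_nat (a + q * j) / of_nat (q * L)) (z ^ (q * L))) =
         of_nat q ^ (k - 1) * z ^ a * twisted_bernoulli k (of_nat a / of_nat q) (z ^ q)"
proof -
  define V where "V = twisted_exp z ^ q"
  define I where "I = inverse (V ^ L - 1)"
  have W: "twisted_exp z ^ (a + q * j) = twisted_exp z ^ a * V ^ j" for j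
    by (simp only: V_def power_add power_mult)
  have VL: "V ^ L = twisted_exp z ^ (q * L)" by (simp only: V_def power_mult)
  have V: "fps_nth (V - 1) 0 \<noteq> 0" "fps_nth (V ^ L - 1) 0 \<noteq> 0"
    using assms(1,2) by (simp_all add: VL twisted_exp_power) (simp_all add: V_def twisted_exp_power)
  have "(V - 1) * (\<Sum>j<L. V ^ j) * I = 1"
    unfolding I_def power_diff_1_eq[symmetric] using inverse_mult_eq_1[OF V(2)] by (simp add: mult.commute)
  then have I: "(\<Sum>j<L. V ^ j) * I = inverse (V - 1)"
    using fps_inverse_unique[of "V - 1" "(\<Sum>j<L. V ^ j) * I"] by (simp only: mult.assoc)
  have "(\<Sum>j<L. of_nat (q * L) ^ (k - 1) * z ^ (a + q * j) *
            twisted_bernoulli k (of_nat (a + q * j) / of_nat (q * L)) (z ^ (q * L)))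
      = (\<Sum>j<L. fact k * fps_nth (fps_X * twisted_exp z ^ (a + q * j) * I) k)"
  proof (rule sum.cong[OF refl])
    fix j
    show "of_nat (q * L) ^ (k - 1) * z ^ (a + q * j) *
            twisted_bernoulli k (of_nat (a + q * j) / of_nat (q * L)) (z ^ (q * L)) =
      fact k * fps_nth (fps_X * twisted_exp z ^ (a + q * j) * I) k"
      using assms by (subst scaled_twisted_bernoulli_eq_nth) (auto simp: I_def V_def power_mult)
  qed
  also have "\<dots> = fact k * fps_nth (\<Sum>j<L. fps_X * twisted_exp z ^ (a + q * j) * I) k"
    by (simp only: fps_sum_nth sum_distrib_left)
  also have "(\<Sum>j<L. fps_X * twisted_exp z ^ (a + q * j) * I) =
      fps_X * twisted_exp z ^ a * ((\<Sum>j<L. V ^ j) * I)"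
    by (simp only: W sum_distrib_left sum_distrib_right mult.assoc)
  also have "fact k * fps_nth \<dots> k =
      of_nat q ^ (k - 1) * z ^ a * twisted_bernoulli k (of_nat a / of_nat q) (z ^ q)"
    unfolding I unfolding V_def using assms by (intro scaled_twisted_bernoulli_eq_nth[symmetric])
  finally show ?thesis .
qed

section \<open>Non-archimedean norms extending the p-adic one\<close>

text \<open>
  Complete fields of characteristic 0 whose metric comes from an absolute value extending the
  \<open>p\<close>-adic one, such as \<open>\<complex>\<^sub>p\<close>.
\<close>

locale padic_normed_field =
  fixes p :: nat and nrm :: "'a::{field_char_0, complete_space} \<Rightarrow> real"
  assumes prime_p: "prime p"
    and dist_nrm: "dist x y = nrm (x - y)"
    and nrm_mult: "nrm (x * y) = nrm x * nrm y"
    and nrm_ultrametric: "nrm (x + y) \<le> max (nrm x) (nrm y)"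
    and nrm_p: "nrm (of_nat p) = 1 / real p"
begin

lemma p_gt_1: "p > 1"
  using prime_p by (rule prime_gt_1_nat)

lemma nrm_nonneg [simp]: "nrm x \<ge> 0"
  by (metis diff_zero dist_nrm zero_le_dist)

lemma nrm_0 [simp]: "nrm 0 = 0"
  by (metis diff_self dist_nrm dist_self)

lemma nrm_eq_0_iff [simp]: "nrm x = 0 \<longleftrightarrow> x = 0"
  by (metis diff_zero dist_nrm dist_eq_0_iff)

lemma nrm_1 [simp]: "nrm 1 = 1"
  by (metis mult_cancel_left2 nrm_eq_0_iff nrm_mult zero_neq_one mult_1)

lemma nrm_diff_commute: "nrm (x - y) = nrm (y - x)"
  by (metis dist_commute dist_nrm)

lemma nrm_minus [simp]: "nrm (- x) = nrm x"
  by (metis diff_0 diff_zero nrm_diff_commute)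

lemma nrm_diff_ultrametric: "nrm (x - y) \<le> max (nrm x) (nrm y)"
  by (metis add_uminus_conv_diff nrm_minus nrm_ultrametric)

lemma nrm_triangle_ultrametric: "nrm (x - z) \<le> max (nrm (x - y)) (nrm (y - z))"
  using nrm_ultrametric[of "x - y" "y - z"] by simp

lemma nrm_power: "nrm (x ^ n) = nrm x ^ n"
  by (induction n) (auto simp: nrm_mult)

lemma nrm_inverse: "nrm (inverse x) = inverse (nrm x)"
proof (cases "x = 0")
  case False
  then have "nrm x * nrm (inverse x) = 1" by (simp flip: nrm_mult)
  then show ?thesis by (simp add: inverse_unique)
qed simp

lemma nrm_sum_le:
  assumes "\<And>i. i \<in> A \<Longrightarrow> nrm (f i) \<le> B" "B \<ge> 0"
  shows "nrm (sum f A) \<le> B"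
  using assms
proof (induction A rule: infinite_finite_induct)
  case (insert x F)
  then show ?case using nrm_ultrametric[of "f x" "sum f F"] by fastforce
qed auto

text \<open>
  The isosceles triangle principle.
\<close>

lemma nrm_add_eq:
  assumes "nrm y < nrm x"
  shows "nrm (x + y) = nrm x"
  using nrm_ultrametric[of x y] nrm_diff_ultrametric[of "x + y" y] assms by auto

lemma nrm_of_nat_le_1: "nrm (of_nat n) \<le> 1"
proof (induction n)
  case (Suc n)
  then show ?case using nrm_ultrametric[of 1 "of_nat n"] by simp
qed simp

lemma nrm_of_int_le_1: "nrm (of_int n) \<le> 1"
  by (cases n rule: int_cases2) (simp_all add: nrm_of_nat_le_1)

lemma nrm_p_power: "nrm (of_nat p ^ N) = 1 / real p ^ N"
  by (simp add: nrm_power nrm_p power_one_over)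

lemma inverse_p_le_1: "1 / real p ^ N \<le> 1"
  using p_gt_1 by simp

lemma nrm_of_int_le_of_dvd:
  assumes "int p ^ N dvd n"
  shows "nrm (of_int n) \<le> 1 / real p ^ N"
proof -
  obtain m where "n = int p ^ N * m" using assms by auto
  then have "nrm (of_int n) = 1 / real p ^ N * nrm (of_int m)"
    by (simp add: nrm_mult nrm_p_power)
  also have "\<dots> \<le> 1 / real p ^ N * 1"
    by (intro mult_left_mono nrm_of_int_le_1) simp
  finally show ?thesis by simp
qed

text \<open>
  A Bezout relation \<open>u n + v p = 1\<close> shows that \<open>n\<close> is a unit modulo \<open>p\<close>, and the term \<open>v p\<close> is
  too small to contribute to the norm of the sum.
\<close>

lemma nrm_of_int_eq_1:
  assumes "\<not> int p dvd n"
  shows "nrm (of_int n) = 1"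
proof -
  have "coprime n (int p)"
    using assms prime_p prime_imp_coprime[of "int p" n] by (simp add: coprime_commute)
  then obtain u v where "u * n + v * int p = 1"
    using bezout_int[of n "int p"] by auto
  then have eq: "(of_int u * of_int n + of_int v * of_nat p :: 'a) = 1"
    by (metis of_int_1 of_int_add of_int_mult of_int_of_nat_eq)
  have "nrm (of_int v * of_nat p) \<le> 1 * (1 / real p)"
    unfolding nrm_mult nrm_p by (intro mult_right_mono nrm_of_int_le_1) simp
  also have "\<dots> < 1" using p_gt_1 by simp
  finally have "1 \<le> nrm (of_int u) * nrm (of_int n)"
    using nrm_ultrametric[of "of_int u * of_int n" "of_int v * of_nat p"]
    by (simp add: eq nrm_mult)
  also have "\<dots> \<le> 1 * nrm (of_int n)"
    by (intro mult_right_mono nrm_of_int_le_1) simp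
  finally show ?thesis using nrm_of_int_le_1[of n] by simp
qed

lemma nrm_of_int_le_iff: "nrm (of_int n) \<le> 1 / real p ^ N \<longleftrightarrow> int p ^ N dvd n"
proof
  assume "nrm (of_int n) \<le> 1 / real p ^ N"
  then show "int p ^ N dvd n"
  proof (induction N)
    case (Suc N)
    have "1 / real p ^ Suc N \<le> 1 / real p ^ N"
      using p_gt_1 by (intro divide_left_mono power_increasing) auto
    with Suc obtain m where m: "n = int p ^ N * m" by (auto simp: dvd_def)
    have "nrm (of_int n) = 1 / real p ^ N * nrm (of_int m)"
      by (simp add: m nrm_mult nrm_p_power)
    then have "nrm (of_int m) \<le> 1 / real p"
      using Suc.prems p_gt_1 by (simp add: field_simps)
    also have "\<dots> < 1" using p_gt_1 by simp
    finally have "int p dvd m" using nrm_of_int_eq_1 by force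
    then show ?case by (simp add: m mult.commute)
  qed simp
qed (rule nrm_of_int_le_of_dvd)

lemma nrm_of_nat_diff_le_iff:
  "nrm (of_nat a - of_nat b) \<le> 1 / real p ^ N \<longleftrightarrow> a mod p ^ N = b mod p ^ N"
proof -
  have "nrm (of_nat a - of_nat b) = nrm (of_int (int a - int b))" by simp
  also have "\<dots> \<le> 1 / real p ^ N \<longleftrightarrow> int a mod int p ^ N = int b mod int p ^ N"
    by (simp only: nrm_of_int_le_iff mod_eq_dvd_iff)
  also have "\<dots> \<longleftrightarrow> a mod p ^ N = b mod p ^ N"
    by (metis of_nat_eq_iff of_nat_mod of_nat_power)
  finally show ?thesis .
qed

lemma nrm_of_nat_eq_1: "\<not> p dvd n \<Longrightarrow> nrm (of_nat n) = 1"
  using nrm_of_int_eq_1[of "int n"] by simp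

section \<open>Distance of powers from 1\<close>

lemma nrm_power_minus_1_large:
  assumes "nrm z > 1" "q > 0"
  shows "nrm (z ^ q - 1) = nrm z ^ q"
proof -
  have "nrm (-1) < nrm (z ^ q)" using assms by (simp add: nrm_power)
  from nrm_add_eq[OF this] show ?thesis by (simp add: nrm_power)
qed

text \<open>
  If \<open>\<bar>z\<bar> > 1\<close>, then \<open>z\<^sup>p\<close> dominates.  Otherwise \<open>u = z - 1\<close> has norm 1 and
  \<open>z\<^sup>p - 1 = (1 + u)\<^sup>p - 1\<close> is \<open>u\<^sup>p\<close> up to binomial terms divisible by \<open>p\<close>.
\<close>

lemma nrm_power_p_minus_1:
  assumes "nrm (z - 1) \<ge> 1"
  shows "nrm (z ^ p - 1) \<ge> 1"
proof (cases "nrm z > 1")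
  case True
  then show ?thesis using nrm_power_minus_1_large[OF True, of p] p_gt_1 by simp
next
  case False
  define u where "u = z - 1"
  have u: "nrm u = 1"
    using assms False nrm_diff_ultrametric[of z 1] by (simp add: u_def)
  define s where "s = (\<Sum>j\<in>{1..<p}. of_nat (p choose j) * u ^ j)"
  have "{..p} = insert 0 (insert p {1..<p})" using p_gt_1 by auto
  moreover have "z ^ p = (u + 1) ^ p" by (simp add: u_def)
  ultimately have eq: "z ^ p - 1 = u ^ p + s"
    using p_gt_1 by (simp add: binomial_ring s_def)
  have "nrm s \<le> 1 / real p"
    unfolding s_def
  proof (rule nrm_sum_le)
    fix j assume "j \<in> {1..<p}"
    then have "p dvd p choose j" using prime_p by (intro dvd_choose_prime) auto
    then have "int p ^ 1 dvd int (p choose j)" by simp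
    from nrm_of_int_le_of_dvd[OF this] show "nrm (of_nat (p choose j) * u ^ j) \<le> 1 / real p"
      by (simp add: nrm_mult nrm_power u)
  qed simp
  also have "\<dots> < nrm (u ^ p)" using p_gt_1 by (simp add: nrm_power u)
  finally show ?thesis using nrm_add_eq[of s "u ^ p"] by (simp add: eq nrm_power u)
qed

lemma nrm_power_p_power_minus_1:
  assumes "nrm (z - 1) \<ge> 1"
  shows "nrm (z ^ (p ^ N) - 1) \<ge> 1"
proof (induction N)
  case (Suc N)
  have "z ^ (p ^ Suc N) = (z ^ (p ^ N)) ^ p" by (simp add: mult.commute flip: power_mult)
  then show ?case using nrm_power_p_minus_1[OF Suc] by metis
qed (use assms in simp)

text \<open>
  This compensates the growth of \<open>z\<^sup>a\<close> in the values of the measures when \<open>\<bar>z\<bar> > 1\<close>.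
\<close>

lemma nrm_power_le_nrm_power_minus_1:
  assumes "nrm (z - 1) \<ge> 1" "a \<le> p ^ N"
  shows "nrm (z ^ a) \<le> nrm (z ^ (p ^ N) - 1)"
proof (cases "nrm z > 1")
  case True
  then show ?thesis
    using nrm_power_minus_1_large[OF True, of "p ^ N"] p_gt_1 assms(2)
    by (simp add: nrm_power power_increasing)
next
  case False
  then have "nrm (z ^ a) \<le> 1" by (simp add: nrm_power power_le_one)
  then show ?thesis using nrm_power_p_power_minus_1[OF assms(1), of N] by linarith
qed

section \<open>Compact open sets of p-adic integers\<close>

lemma inverse_p_power_less:
  assumes "e > 0"
  obtains N where "1 / real p ^ N < e"
  using real_arch_pow_inv[of e "1 / real p"] assms p_gt_1 by (auto simp: power_one_over)

lemma padic_integers_iff: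
  "x \<in> padic_integers \<longleftrightarrow> (\<forall>N. \<exists>n::int. nrm (x - of_int n) \<le> 1 / real p ^ N)"
proof
  assume x: "x \<in> padic_integers"
  show "\<forall>N. \<exists>n::int. nrm (x - of_int n) \<le> 1 / real p ^ N"
  proof
    fix N
    have "1 / real p ^ N > 0" using p_gt_1 by simp
    then obtain y where "y \<in> \<int>" "dist y x < 1 / real p ^ N"
      using x unfolding padic_integers_def closure_approachable by blast
    then show "\<exists>n::int. nrm (x - of_int n) \<le> 1 / real p ^ N"
      by (metis Ints_cases dist_commute dist_nrm less_imp_le)
  qed
next
  assume *: "\<forall>N. \<exists>n::int. nrm (x - of_int n) \<le> 1 / real p ^ N"
  show "x \<in> padic_integers"
    unfolding padic_integers_def closure_approachable
  proof (intro allI impI)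
    fix e :: real assume "e > 0"
    then obtain N where "1 / real p ^ N < e" by (rule inverse_p_power_less)
    moreover obtain n :: int where "nrm (x - of_int n) \<le> 1 / real p ^ N" using * by blast
    ultimately have "dist (of_int n) x < e" by (simp add: dist_nrm nrm_diff_commute)
    then show "\<exists>y\<in>\<int>. dist y x < e" by (intro bexI[of _ "of_int n"]) auto
  qed
qed

lemma of_nat_in_padic_integers [simp]: "of_nat n \<in> padic_integers"
  unfolding padic_integers_def by (rule subsetD[OF closure_subset]) simp

lemma nrm_padic_integer_le_1:
  assumes "x \<in> padic_integers"
  shows "nrm x \<le> 1"
proof -
  obtain n :: int where "nrm (x - of_int n) \<le> 1 / real p ^ 0"
    using assms padic_integers_iff by blast
  then show ?thesis
    using nrm_ultrametric[of "x - of_int n" "of_int n"] nrm_of_int_le_1[of n] by simp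
qed

lemma padic_integer_residue:
  assumes "x \<in> padic_integers"
  obtains a where "a < p ^ N" "nrm (x - of_nat a) \<le> 1 / real p ^ N"
proof -
  obtain n :: int where n: "nrm (x - of_int n) \<le> 1 / real p ^ N"
    using assms padic_integers_iff by blast
  define a where "a = nat (n mod int p ^ N)"
  have p0: "int p ^ N > 0" using p_gt_1 by simp
  then have a: "int a = n mod int p ^ N" by (simp add: a_def)
  then have "int a < int (p ^ N)" using p0 by simp
  then have "a < p ^ N" by linarith
  moreover have "nrm (of_int n - of_nat a) \<le> 1 / real p ^ N"
  proof -
    have "int p ^ N dvd n - int a" by (simp add: a minus_mod_eq_mult_div)
    from nrm_of_int_le_of_dvd[OF this] show ?thesis by simp
  qed
  then have "nrm (x - of_nat a) \<le> 1 / real p ^ N"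
    using nrm_triangle_ultrametric[of x "of_nat a" "of_int n"] n by simp
  ultimately show ?thesis using that by blast
qed

text \<open>
  Residue classes are balls.  For the inclusion of the ball, an integer close to \<open>x\<close> is congruent
  to \<open>a\<close> modulo \<open>p\<^sup>N\<close>, so dividing the approximations of \<open>x - a\<close> by \<open>p\<^sup>N\<close> gives integers again.
\<close>

lemma padic_coset_eq:
  "padic_coset p a N = {x::'a. x \<in> padic_integers \<and> nrm (x - of_nat a) \<le> 1 / real p ^ N}"
proof (intro equalityI subsetI)
  fix x :: 'a assume "x \<in> padic_coset p a N"
  then obtain y where y: "y \<in> padic_integers" and x: "x = of_nat a + of_nat p ^ N * y"
    by (auto simp: padic_coset_def)
  have "x \<in> padic_integers"
    unfolding padic_integers_iff
  proof
    fix M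
    obtain n :: int where n: "nrm (y - of_int n) \<le> 1 / real p ^ M"
      using y padic_integers_iff by blast
    have "x - of_int (int a + int p ^ N * n) = of_nat p ^ N * (y - of_int n)"
      by (simp add: x algebra_simps)
    then have "nrm (x - of_int (int a + int p ^ N * n)) = 1 / real p ^ N * nrm (y - of_int n)"
      by (simp only: nrm_mult nrm_p_power)
    also have "\<dots> \<le> 1 * (1 / real p ^ M)"
      by (intro mult_mono n inverse_p_le_1) auto
    finally have "nrm (x - of_int (int a + int p ^ N * n)) \<le> 1 / real p ^ M" by (simp only: mult_1)
    then show "\<exists>n::int. nrm (x - of_int n) \<le> 1 / real p ^ M" ..
  qed
  moreover have "nrm (x - of_nat a) \<le> 1 / real p ^ N"
    using mult_left_mono[OF nrm_padic_integer_le_1[OF y], of "1 / real p ^ N"]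
    by (simp add: x nrm_mult nrm_p_power)
  ultimately show "x \<in> {x. x \<in> padic_integers \<and> nrm (x - of_nat a) \<le> 1 / real p ^ N}" by simp
next
  fix x :: 'a assume "x \<in> {x. x \<in> padic_integers \<and> nrm (x - of_nat a) \<le> 1 / real p ^ N}"
  then have x: "x \<in> padic_integers" and xa: "nrm (x - of_nat a) \<le> 1 / real p ^ N" by auto
  have p0: "(of_nat p :: 'a) ^ N \<noteq> 0" using p_gt_1 by simp
  define y where "y = (x - of_nat a) / of_nat p ^ N"
  have xy: "x = of_nat a + of_nat p ^ N * y" using p0 by (simp add: y_def)
  have "y \<in> padic_integers"
    unfolding padic_integers_iff
  proof
    fix M
    \<comment> \<open>Division by \<open>p\<^sup>N\<close> loses \<open>N\<close> digits of precision.\<close>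
    obtain n :: int where n: "nrm (x - of_int n) \<le> 1 / real p ^ (M + N)"
      using x padic_integers_iff by blast
    also have "\<dots> \<le> 1 / real p ^ N"
      using p_gt_1 by (intro divide_left_mono power_increasing) auto
    finally have "nrm (of_int n - of_nat a) \<le> 1 / real p ^ N"
      using nrm_triangle_ultrametric[of "of_int n" "of_nat a" x] xa
      by (simp add: nrm_diff_commute[of "of_int n" x])
    then have "int p ^ N dvd n - int a"
      by (subst nrm_of_int_le_iff[symmetric]) simp
    then obtain m where m: "n = int a + int p ^ N * m" by (metis dvd_def diff_add_cancel add.commute)
    have "x - of_int n = of_nat p ^ N * (y - of_int m)" by (simp add: xy m algebra_simps)
    then have "nrm (x - of_int n) = 1 / real p ^ N * nrm (y - of_int m)"
      by (simp only: nrm_mult nrm_p_power)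
    then have "nrm (y - of_int m) \<le> 1 / real p ^ M"
      using n p_gt_1 by (simp add: power_add field_simps)
    then show "\<exists>n::int. nrm (y - of_int n) \<le> 1 / real p ^ M" ..
  qed
  then show "x \<in> padic_coset p a N" using xy by (auto simp: padic_coset_def)
qed

lemma of_nat_in_padic_coset_iff: "(of_nat b :: 'a) \<in> padic_coset p a N \<longleftrightarrow> b mod p ^ N = a mod p ^ N"
  by (simp add: padic_coset_eq nrm_of_nat_diff_le_iff)

lemma padic_cosets_disjoint:
  assumes "a < p ^ N" "b < p ^ N" "a \<noteq> b"
  shows "padic_coset p a N \<inter> padic_coset p b N = ({} :: 'a set)"
proof (rule ccontr)
  assume "padic_coset p a N \<inter> padic_coset p b N \<noteq> ({} :: 'a set)"
  then obtain x :: 'a where "nrm (x - of_nat a) \<le> 1 / real p ^ N" "nrm (x - of_nat b) \<le> 1 / real p ^ N"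
    by (auto simp: padic_coset_eq)
  then have "nrm (of_nat a - of_nat b) \<le> 1 / real p ^ N"
    using nrm_triangle_ultrametric[of "of_nat a" "of_nat b" x] by (simp add: nrm_diff_commute)
  then show False using assms by (simp add: nrm_of_nat_diff_le_iff)
qed

text \<open>
  The integers \<open>0, \<dots>, p\<^sup>N - 1\<close> form a finite net of mesh \<open>p\<^sup>-\<^sup>N\<close>.
\<close>

lemma compact_padic_integers: "compact (padic_integers :: 'a set)"
  unfolding compact_eq_totally_bounded
proof (intro conjI allI impI)
  show "complete (padic_integers :: 'a set)"
    by (simp add: complete_eq_closed padic_integers_def)
  fix e :: real assume "e > 0"
  then obtain N where N: "1 / real p ^ N < e" by (rule inverse_p_power_less)
  have "(padic_integers :: 'a set) \<subseteq> (\<Union>x\<in>of_nat ` {..<p ^ N}. ball x e)"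
  proof
    fix x :: 'a assume "x \<in> padic_integers"
    then obtain a where "a < p ^ N" "nrm (x - of_nat a) \<le> 1 / real p ^ N"
      by (rule padic_integer_residue)
    then have "x \<in> ball (of_nat a) e" "of_nat a \<in> (of_nat ` {..<p ^ N} :: 'a set)"
      using N by (auto simp: dist_nrm nrm_diff_commute[of _ x])
    then show "x \<in> (\<Union>x\<in>of_nat ` {..<p ^ N}. ball x e)" by (rule UN_I[rotated])
  qed
  then show "\<exists>k. finite k \<and> (padic_integers :: 'a set) \<subseteq> (\<Union>x\<in>k. ball x e)"
    by (intro exI[of _ "of_nat ` {..<p ^ N}"]) auto
qed

lemma open_nrm_ball:
  assumes "r > 0"
  shows "open {x. nrm (x - c) \<le> r}"
  unfolding open_dist
proof (intro ballI exI conjI allI impI)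
  fix x y assume "x \<in> {x. nrm (x - c) \<le> r}" "dist y x < r"
  then show "y \<in> {x. nrm (x - c) \<le> r}"
    using nrm_triangle_ultrametric[of y c x] by (simp add: dist_nrm)
qed (rule assms)

lemma padic_coset_in_compact_opens: "(padic_coset p a N :: 'a set) \<in> compact_opens"
proof -
  have "padic_coset p a N = (padic_integers :: 'a set) \<inter> cball (of_nat a) (1 / real p ^ N)"
    by (auto simp: padic_coset_eq dist_nrm nrm_diff_commute)
  then have "compact (padic_coset p a N :: 'a set)"
    by (simp add: compact_Int_closed compact_padic_integers)
  moreover have "padic_coset p a N = (padic_integers :: 'a set) \<inter> {x. nrm (x - of_nat a) \<le> 1 / real p ^ N}"
    by (auto simp: padic_coset_eq)
  then have "openin (top_of_set padic_integers) (padic_coset p a N :: 'a set)"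
    using open_nrm_ball[of "1 / real p ^ N"] p_gt_1 by (auto simp: openin_open)
  ultimately show ?thesis by (simp add: compact_opens_def)
qed

lemma empty_in_compact_opens: "{} \<in> (compact_opens :: 'a set set)"
  by (simp add: compact_opens_def)

lemma Un_in_compact_opens:
  "U \<in> compact_opens \<Longrightarrow> V \<in> compact_opens \<Longrightarrow> U \<union> V \<in> (compact_opens :: 'a set set)"
  by (auto simp: compact_opens_def compact_Un openin_Un)

definition coset_saturated :: "'a set \<Rightarrow> nat \<Rightarrow> bool" where
  "coset_saturated U N \<longleftrightarrow> U \<subseteq> padic_integers \<and>
     (\<forall>x\<in>U. \<forall>y\<in>padic_integers. nrm (x - y) \<le> 1 / real p ^ N \<longrightarrow> y \<in> U)"

lemma coset_saturated_mono:
  assumes "coset_saturated U N" "N \<le> M"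
  shows "coset_saturated U M"
proof -
  have "1 / real p ^ M \<le> 1 / real p ^ N"
    using p_gt_1 assms(2) by (intro divide_left_mono power_increasing) auto
  then show ?thesis using assms(1) unfolding coset_saturated_def by (meson order_trans)
qed

lemma coset_saturated_Un:
  "coset_saturated U N \<Longrightarrow> coset_saturated V N \<Longrightarrow> coset_saturated (U \<union> V) N"
  unfolding coset_saturated_def by blast

lemma coset_saturated_padic_coset: "coset_saturated (padic_coset p a N) N"
proof -
  have "nrm (y - of_nat a) \<le> 1 / real p ^ N"
    if "nrm (x - of_nat a) \<le> 1 / real p ^ N" "nrm (x - y) \<le> 1 / real p ^ N" for x y
    using nrm_triangle_ultrametric[of y "of_nat a" x] that by (simp add: nrm_diff_commute)
  then show ?thesis by (auto simp: coset_saturated_def padic_coset_eq)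
qed

text \<open>
  The Lebesgue number of the trivial cover of \<open>U\<close> by one open set gives a radius that works for
  all points of \<open>U\<close>.
\<close>

lemma compact_open_saturated:
  assumes "U \<in> compact_opens"
  obtains N where "coset_saturated U N"
proof -
  have "compact U" using assms by (simp add: compact_opens_def)
  obtain T where T: "open T" "U = padic_integers \<inter> T"
    using assms by (auto simp: compact_opens_def openin_open)
  obtain e where e: "e > 0" "\<And>x. x \<in> U \<Longrightarrow> ball x e \<subseteq> T"
    using Heine_Borel_lemma[OF \<open>compact U\<close>, of "{T}"] T by auto
  obtain N where N: "1 / real p ^ N < e" using e(1) by (rule inverse_p_power_less)
  have "coset_saturated U N"
    unfolding coset_saturated_def
  proof (intro conjI ballI impI)
    show "U \<subseteq> padic_integers" using T by auto
    fix x y assume "x \<in> U" "y \<in> padic_integers" "nrm (x - y) \<le> 1 / real p ^ N"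
    then have "y \<in> ball x e" using N by (simp add: dist_nrm)
    then show "y \<in> U" using e(2)[OF \<open>x \<in> U\<close>] T(2) \<open>y \<in> padic_integers\<close> by auto
  qed
  then show ?thesis using that by blast
qed

lemma coset_saturated_eq_Union:
  assumes "coset_saturated U N"
  shows "U = (\<Union>a\<in>{a. a < p ^ N \<and> of_nat a \<in> U}. padic_coset p a N)"
proof (intro equalityI subsetI)
  fix x :: 'a assume x: "x \<in> U"
  then have "x \<in> padic_integers" using assms by (auto simp: coset_saturated_def)
  then obtain a where a: "a < p ^ N" "nrm (x - of_nat a) \<le> 1 / real p ^ N"
    by (rule padic_integer_residue)
  then have "of_nat a \<in> U" using assms x by (auto simp: coset_saturated_def)
  then show "x \<in> (\<Union>a\<in>{a. a < p ^ N \<and> of_nat a \<in> U}. padic_coset p a N)"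
    using a \<open>x \<in> padic_integers\<close> by (auto simp: padic_coset_eq)
next
  fix x :: 'a assume "x \<in> (\<Union>a\<in>{a. a < p ^ N \<and> of_nat a \<in> U}. padic_coset p a N)"
  then obtain a where "of_nat a \<in> U" "x \<in> padic_integers" "nrm (of_nat a - x) \<le> 1 / real p ^ N"
    by (auto simp: padic_coset_eq nrm_diff_commute)
  then show "x \<in> U" using assms by (auto simp: coset_saturated_def)
qed

lemma coset_saturated_of_nat_mod:
  assumes "coset_saturated U N"
  shows "of_nat b \<in> U \<longleftrightarrow> of_nat (b mod p ^ N) \<in> U"
proof -
  have "nrm (of_nat b - of_nat (b mod p ^ N)) \<le> 1 / real p ^ N"
    by (simp add: nrm_of_nat_diff_le_iff)
  then show ?thesis
    using assms unfolding coset_saturated_def by (metis nrm_diff_commute of_nat_in_padic_integers)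
qed

section \<open>Measures from compatible values on residue classes\<close>

text \<open>
  Here \<open>m a N\<close> stands for the mass of the class of \<open>a\<close> modulo \<open>p\<^sup>N\<close>.
\<close>

definition padic_distribution :: "(nat \<Rightarrow> nat \<Rightarrow> 'a) \<Rightarrow> bool" where
  "padic_distribution m \<longleftrightarrow> (\<forall>N M a. N \<le> M \<longrightarrow> a < p ^ N \<longrightarrow>
     (\<Sum>b | b < p ^ M \<and> b mod p ^ N = a. m b M) = m a N)"

text \<open>
  A Riemann sum of a function that is constant modulo \<open>p\<^sup>N\<close> does not change under refinement.
  The predicate \<open>P\<close> selects the domain: a compact open set, all of \<open>\<int>\<^sub>p\<close>, or its units.
\<close>

lemma sum_coset_refinement:
  assumes m: "padic_distribution m" and le: "N \<le> M"
    and P: "\<And>b. P b \<longleftrightarrow> P (b mod p ^ N)"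
  shows "(\<Sum>b | b < p ^ M \<and> P b. g (b mod p ^ N) * m b M) = (\<Sum>a | a < p ^ N \<and> P a. g a * m a N)"
proof -
  have "(\<Sum>a | a < p ^ N \<and> P a. g a * m a N) =
      (\<Sum>a | a < p ^ N \<and> P a. \<Sum>b\<in>{b \<in> {b. b < p ^ M \<and> P b}. b mod p ^ N = a}. g (b mod p ^ N) * m b M)"
  proof (rule sum.cong[OF refl])
    fix a assume a: "a \<in> {a. a < p ^ N \<and> P a}"
    have "{b \<in> {b. b < p ^ M \<and> P b}. b mod p ^ N = a} = {b. b < p ^ M \<and> b mod p ^ N = a}"
      using a P by auto
    moreover have "m a N = (\<Sum>b | b < p ^ M \<and> b mod p ^ N = a. m b M)"
      using m le a by (simp add: padic_distribution_def)
    ultimately show "g a * m a N =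
        (\<Sum>b\<in>{b \<in> {b. b < p ^ M \<and> P b}. b mod p ^ N = a}. g (b mod p ^ N) * m b M)"
      by (simp add: sum_distrib_left)
  qed
  also have "\<dots> = (\<Sum>b | b < p ^ M \<and> P b. g (b mod p ^ N) * m b M)"
    using p_gt_1 P by (intro sum.group) auto
  finally show ?thesis by simp
qed

lemma padic_measure_Union_cosets:
  fixes \<mu> :: "'a set \<Rightarrow> 'a"
  assumes \<mu>: "padic_measure \<mu>" and A: "A \<subseteq> {..<p ^ N}"
  shows "(\<Union>a\<in>A. padic_coset p a N) \<in> (compact_opens :: 'a set set) \<and>
    \<mu> (\<Union>a\<in>A. padic_coset p a N) = (\<Sum>a\<in>A. \<mu> (padic_coset p a N))"
proof -
  have add: "\<mu> (U \<union> V) = \<mu> U + \<mu> V" if "U \<in> compact_opens" "V \<in> compact_opens" "U \<inter> V = {}" for U V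
    using \<mu> that by (simp add: padic_measure_def)
  have "finite A" using A finite_subset by blast
  then show ?thesis using A
  proof (induction A)
    case empty
    then show ?case using add[of "{}" "{}"] by (simp add: empty_in_compact_opens)
  next
    case (insert x F)
    let ?U = "\<Union>a\<in>F. padic_coset p a N :: 'a set"
    have "padic_coset p x N \<inter> ?U = ({} :: 'a set)"
      using insert.prems insert.hyps padic_cosets_disjoint[of x N] by fastforce
    then show ?case
      using insert add[OF padic_coset_in_compact_opens, of ?U x N]
      by (auto intro!: Un_in_compact_opens padic_coset_in_compact_opens)
  qed
qed

lemma padic_measure_eqI:
  fixes \<mu> \<nu> :: "'a set \<Rightarrow> 'a"
  assumes "padic_measure \<mu>" "padic_measure \<nu>" "\<mu> \<in> extensional compact_opens" "\<nu> \<in> extensional compact_opens"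
    and eq: "\<And>N a. a < p ^ N \<Longrightarrow> \<mu> (padic_coset p a N) = \<nu> (padic_coset p a N)"
  shows "\<mu> = \<nu>"
proof (rule extensionalityI)
  fix U :: "'a set" assume "U \<in> compact_opens"
  then obtain N where "coset_saturated U N" by (rule compact_open_saturated)
  define A where "A = {a. a < p ^ N \<and> of_nat a \<in> U}"
  have U: "U = (\<Union>a\<in>A. padic_coset p a N)"
    using coset_saturated_eq_Union[OF \<open>coset_saturated U N\<close>] by (simp add: A_def)
  have A: "A \<subseteq> {..<p ^ N}" by (auto simp: A_def)
  have "\<mu> U = (\<Sum>a\<in>A. \<mu> (padic_coset p a N))"
    using padic_measure_Union_cosets[OF assms(1) A] U by simp
  also have "\<dots> = (\<Sum>a\<in>A. \<nu> (padic_coset p a N))"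
    using A eq by (intro sum.cong) auto
  also have "\<dots> = \<nu> U"
    using padic_measure_Union_cosets[OF assms(2) A] U by simp
  finally show "\<mu> U = \<nu> U" .
qed (use assms in auto)

text \<open>
  The level is the least one at which \<open>U\<close> is a union of residue classes; refinement
  invariance makes any larger level equally good.
\<close>

definition distribution_measure :: "(nat \<Rightarrow> nat \<Rightarrow> 'a) \<Rightarrow> 'a set \<Rightarrow> 'a" where
  "distribution_measure m = restrict (\<lambda>U. \<Sum>a | a < p ^ (LEAST N. coset_saturated U N) \<and> of_nat a \<in> U.
     m a (LEAST N. coset_saturated U N)) compact_opens"

lemma distribution_measure_eq:
  assumes m: "padic_distribution m" and U: "U \<in> compact_opens" and N: "coset_saturated U N"
  shows "distribution_measure m U = (\<Sum>a | a < p ^ N \<and> of_nat a \<in> U. m a N)"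
proof -
  define L where "L = (LEAST N. coset_saturated U N)"
  have L: "coset_saturated U L" "L \<le> N"
    using N unfolding L_def by (auto intro: LeastI Least_le)
  have "distribution_measure m U = (\<Sum>a | a < p ^ L \<and> of_nat a \<in> U. m a L)"
    using U by (simp add: distribution_measure_def L_def)
  then show ?thesis
    using sum_coset_refinement[OF m L(2), of "\<lambda>a. of_nat a \<in> U" "\<lambda>_. 1"]
      coset_saturated_of_nat_mod[OF L(1)] by simp
qed

lemma distribution_measure_coset:
  assumes "padic_distribution m" "a < p ^ N"
  shows "distribution_measure m (padic_coset p a N) = m a N"
proof -
  have "{b. b < p ^ N \<and> (of_nat b :: 'a) \<in> padic_coset p a N} = {a}"
    using assms(2) by (auto simp: of_nat_in_padic_coset_iff)
  then show ?thesis
    by (simp add: distribution_measure_eq[OF assms(1) padic_coset_in_compact_opens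
          coset_saturated_padic_coset])
qed

text \<open>
  Two sets are compared at a common level, where additivity is additivity of finite sums.
  Boundedness is the ultrametric inequality.
\<close>

lemma padic_measure_distribution_measure:
  assumes m: "padic_distribution m" and le: "\<And>a N. a < p ^ N \<Longrightarrow> nrm (m a N) \<le> 1"
  shows "padic_measure (distribution_measure m)"
  unfolding padic_measure_def
proof (intro conjI ballI impI)
  fix U V :: "'a set" assume UV: "U \<in> compact_opens" "V \<in> compact_opens" "U \<inter> V = {}"
  obtain K L where "coset_saturated U K" "coset_saturated V L"
    using UV(1,2) by (metis compact_open_saturated)
  then obtain N where N: "coset_saturated U N" "coset_saturated V N"
    by (meson coset_saturated_mono max.cobounded1 max.cobounded2)
  have "{a. a < p ^ N \<and> of_nat a \<in> U \<union> V} =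
      {a. a < p ^ N \<and> of_nat a \<in> U} \<union> {a. a < p ^ N \<and> of_nat a \<in> V}" by auto
  moreover have "{a. a < p ^ N \<and> of_nat a \<in> U} \<inter> {a. a < p ^ N \<and> of_nat a \<in> V} = {}"
    using UV(3) by auto
  ultimately show "distribution_measure m (U \<union> V) = distribution_measure m U + distribution_measure m V"
    by (simp add: distribution_measure_eq[OF m _ N(1)] distribution_measure_eq[OF m _ N(2)] UV
        distribution_measure_eq[OF m Un_in_compact_opens coset_saturated_Un[OF N]] sum.union_disjoint)
next
  have "nrm (distribution_measure m U) \<le> 1" if U: "U \<in> compact_opens" for U
  proof -
    obtain N where N: "coset_saturated U N" using U by (rule compact_open_saturated)
    show ?thesis unfolding distribution_measure_eq[OF m U N] by (rule nrm_sum_le) (auto intro: le)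
  qed
  then have "\<forall>x\<in>distribution_measure m ` compact_opens. dist 0 x \<le> 1"
    by (auto simp: dist_nrm)
  then show "bounded (distribution_measure m ` compact_opens)" unfolding bounded_def by blast
qed

lemma ex1_measure_of_distribution:
  assumes "padic_distribution m" and "\<And>a N. a < p ^ N \<Longrightarrow> nrm (m a N) \<le> 1"
  shows "\<exists>!\<mu>. \<mu> \<in> extensional compact_opens \<and> padic_measure \<mu> \<and>
    (\<forall>N. \<forall>a < p ^ N. \<mu> (padic_coset p a N) = m a N)"
proof (rule ex1I[of _ "distribution_measure m"])
  show "distribution_measure m \<in> extensional compact_opens \<and> padic_measure (distribution_measure m) \<and>
    (\<forall>N. \<forall>a < p ^ N. distribution_measure m (padic_coset p a N) = m a N)"
    using assms padic_measure_distribution_measure distribution_measure_coset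
    by (auto simp: distribution_measure_def)
next
  fix \<mu> assume "\<mu> \<in> extensional compact_opens \<and> padic_measure \<mu> \<and>
    (\<forall>N. \<forall>a < p ^ N. \<mu> (padic_coset p a N) = m a N)"
  then show "\<mu> = distribution_measure m"
    using assms padic_measure_distribution_measure distribution_measure_coset
    by (intro padic_measure_eqI) (auto simp: distribution_measure_def)
qed

section \<open>Convergence of Riemann sums\<close>

lemma inverse_p_power_tendsto_0: "(\<lambda>N. 1 / real p ^ N) \<longlonglongrightarrow> 0"
  using LIMSEQ_inverse_realpow_zero[of "real p"] p_gt_1 by (simp add: divide_inverse)

lemma tendsto_iff_nrm: "X \<longlonglongrightarrow> (L :: 'a) \<longleftrightarrow> (\<lambda>N. nrm (X N - L)) \<longlonglongrightarrow> 0"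
  unfolding tendsto_dist_iff[of X L] by (simp add: dist_nrm)

text \<open>
  The type of scalars carries a metric but no topological ring structure, so continuity of
  multiplication comes from the norm.
\<close>

lemma tendsto_mult_left_nrm:
  assumes "X \<longlonglongrightarrow> (L :: 'a)"
  shows "(\<lambda>N. c * X N) \<longlonglongrightarrow> c * L"
proof -
  have "(\<lambda>N. nrm c * nrm (X N - L)) \<longlonglongrightarrow> nrm c * 0"
    using assms by (intro tendsto_mult_left) (simp add: tendsto_iff_nrm)
  then show ?thesis by (simp add: tendsto_iff_nrm nrm_mult flip: right_diff_distrib)
qed

lemma tendsto_perturb:
  assumes "X \<longlonglongrightarrow> (L :: 'a)" and "\<And>N. nrm (Y N - X N) \<le> 1 / real p ^ N"
  shows "Y \<longlonglongrightarrow> L"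
proof -
  have "(\<lambda>N. max (1 / real p ^ N) (nrm (X N - L))) \<longlonglongrightarrow> max 0 0"
    using assms(1) by (intro tendsto_max inverse_p_power_tendsto_0) (simp add: tendsto_iff_nrm)
  then have lim: "(\<lambda>N. max (1 / real p ^ N) (nrm (X N - L))) \<longlonglongrightarrow> 0" by simp
  have le: "nrm (Y N - L) \<le> max (1 / real p ^ N) (nrm (X N - L))" for N
    using nrm_triangle_ultrametric[of "Y N" L "X N"] assms(2)[of N] by linarith
  show ?thesis
    unfolding tendsto_iff_nrm by (rule real_tendsto_sandwich[OF _ _ tendsto_const lim]) (auto simp: le)
qed

text \<open>
  Refining from level \<open>N\<close> to level \<open>M\<close> changes each value of \<open>g\<close> by at most \<open>p\<^sup>-\<^sup>N\<close>, hence, by the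
  ultrametric inequality, the whole sum by at most \<open>p\<^sup>-\<^sup>N\<close>.  Level 0 is excluded because
  divisibility by \<open>p\<close> can be read off from \<open>b mod p\<^sup>N\<close> only for \<open>N \<ge> 1\<close>.
\<close>

lemma convergent_riemann_sum:
  assumes m: "padic_distribution m" and le: "\<And>a N. a < p ^ N \<Longrightarrow> nrm (m a N) \<le> 1"
    and P: "\<And>N b. N \<ge> 1 \<Longrightarrow> P b \<longleftrightarrow> P (b mod p ^ N)"
    and g: "\<And>a b. P a \<Longrightarrow> P b \<Longrightarrow> nrm (g a - g b) \<le> nrm (of_nat a - of_nat b)"
  shows "convergent (\<lambda>N. \<Sum>a | a < p ^ N \<and> P a. g a * m a N)"
proof -
  define S where "S = (\<lambda>N. \<Sum>a | a < p ^ N \<and> P a. g a * m a N)"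
  have step: "nrm (S M - S N) \<le> 1 / real p ^ N" if "1 \<le> N" "N \<le> M" for N M
  proof -
    have "S M - S N = (\<Sum>b | b < p ^ M \<and> P b. (g b - g (b mod p ^ N)) * m b M)"
      unfolding S_def
      using sum_coset_refinement[OF m that(2), of P g] P[OF that(1)]
      by (simp add: left_diff_distrib sum_subtractf)
    also have "nrm \<dots> \<le> 1 / real p ^ N"
    proof (rule nrm_sum_le)
      fix b assume b: "b \<in> {b. b < p ^ M \<and> P b}"
      then have "nrm (g b - g (b mod p ^ N)) \<le> nrm (of_nat b - of_nat (b mod p ^ N))"
        using P[OF that(1)] by (intro g) auto
      also have "\<dots> \<le> 1 / real p ^ N"
        by (simp add: nrm_of_nat_diff_le_iff)
      finally have "nrm (g b - g (b mod p ^ N)) * nrm (m b M) \<le> 1 / real p ^ N * 1"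
        using le b by (intro mult_mono) auto
      then show "nrm ((g b - g (b mod p ^ N)) * m b M) \<le> 1 / real p ^ N" by (simp add: nrm_mult)
    qed simp
    finally show ?thesis .
  qed
  have "Cauchy S"
    unfolding Cauchy_altdef
  proof (intro allI impI)
    fix e :: real assume "e > 0"
    then obtain N where N: "1 / real p ^ N < e" by (rule inverse_p_power_less)
    have "dist (S m) (S n) < e" if "m \<ge> Suc N" "n > m" for m n
    proof -
      have "nrm (S n - S m) \<le> 1 / real p ^ m" using that by (intro step) auto
      also have "\<dots> \<le> 1 / real p ^ N"
        using p_gt_1 that by (intro divide_left_mono power_increasing) auto
      finally show ?thesis using N by (simp add: dist_nrm nrm_diff_commute)
    qed
    then show "\<exists>M. \<forall>m\<ge>M. \<forall>n>m. dist (S m) (S n) < e" by blast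
  qed
  then show ?thesis unfolding S_def Cauchy_convergent_iff .
qed

text \<open>
  The congruence between the two sets of values is used termwise; in an ultrametric the error of
  the sum is no larger than that of a term.
\<close>

lemma riemann_sum_comparison:
  assumes lim: "(\<lambda>N. \<Sum>a | a < p ^ N \<and> P a. g a * h a * m a N) \<longlonglongrightarrow> L"
    and m': "\<And>a N. a < p ^ N \<Longrightarrow> nrm (m' a N - c * h a * m a N) \<le> 1 / real p ^ N"
    and g: "\<And>a. P a \<Longrightarrow> nrm (g a) \<le> 1"
  shows "(\<lambda>N. \<Sum>a | a < p ^ N \<and> P a. g a * m' a N) \<longlonglongrightarrow> c * L"
proof (rule tendsto_perturb[OF tendsto_mult_left_nrm[OF lim, of c]])
  fix N
  have "(\<Sum>a | a < p ^ N \<and> P a. g a * m' a N) - c * (\<Sum>a | a < p ^ N \<and> P a. g a * h a * m a N)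
      = (\<Sum>a | a < p ^ N \<and> P a. g a * (m' a N - c * h a * m a N))"
    by (simp add: sum_distrib_left right_diff_distrib sum_subtractf mult_ac)
  also have "nrm \<dots> \<le> 1 / real p ^ N"
  proof (rule nrm_sum_le)
    fix a assume "a \<in> {a. a < p ^ N \<and> P a}"
    then have "nrm (g a) * nrm (m' a N - c * h a * m a N) \<le> 1 * (1 / real p ^ N)"
      using g m' by (intro mult_mono) auto
    then show "nrm (g a * (m' a N - c * h a * m a N)) \<le> 1 / real p ^ N" by (simp add: nrm_mult)
  qed simp
  finally show "nrm ((\<Sum>a | a < p ^ N \<and> P a. g a * m' a N) -
      c * (\<Sum>a | a < p ^ N \<and> P a. g a * h a * m a N)) \<le> 1 / real p ^ N" .
qed

lemma nrm_power_diff_le: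
  assumes "nrm x \<le> 1" "nrm y \<le> 1"
  shows "nrm (x ^ n - y ^ n) \<le> nrm (x - y)"
proof (induction n)
  case (Suc n)
  have eq: "x ^ Suc n - y ^ Suc n = x * (x ^ n - y ^ n) + (x - y) * y ^ n"
    by (simp add: algebra_simps)
  have "nrm x * nrm (x ^ n - y ^ n) \<le> 1 * nrm (x - y)"
    by (intro mult_mono assms Suc) auto
  moreover have "nrm (x - y) * nrm (y ^ n) \<le> nrm (x - y) * 1"
    using assms by (intro mult_left_mono) (auto simp: nrm_power power_le_one)
  ultimately show ?case
    unfolding eq using nrm_ultrametric[of "x * (x ^ n - y ^ n)" "(x - y) * y ^ n"]
    by (simp add: nrm_mult)
qed simp

lemma nrm_powi_diff_le:
  assumes "nrm x = 1" "nrm y = 1"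
  shows "nrm (x powi n - y powi n) \<le> nrm (x - y)"
proof (cases "n \<ge> 0")
  case True
  then show ?thesis using nrm_power_diff_le[of x y "nat n"] assms by (simp add: power_int_def)
next
  case False
  define k where "k = nat (- n)"
  have nz: "x \<noteq> 0" "y \<noteq> 0" using assms by auto
  have "x powi n - y powi n = inverse (x ^ k) * (y ^ k - x ^ k) * inverse (y ^ k)"
    using False nz by (simp add: power_int_def k_def field_simps)
  then have "nrm (x powi n - y powi n) = nrm (y ^ k - x ^ k)"
    by (simp only: nrm_mult nrm_inverse nrm_power assms) simp
  also have "\<dots> \<le> nrm (y - x)" using assms by (intro nrm_power_diff_le) auto
  finally show ?thesis by (simp add: nrm_diff_commute)
qed

lemma nrm_powi_eq_1: "nrm x = 1 \<Longrightarrow> nrm (x powi n) = 1"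
  by (simp add: power_int_def nrm_power nrm_inverse)

section \<open>The twisted Bernoulli measures\<close>

definition twisted_bernoulli_distribution :: "nat \<Rightarrow> 'a \<Rightarrow> nat \<Rightarrow> nat \<Rightarrow> 'a" where
  "twisted_bernoulli_distribution k z a N = of_nat p ^ (N * (k - 1)) * z ^ a *
     twisted_bernoulli k (of_nat a / of_nat p ^ N) (z ^ (p ^ N))"

lemma power_p_power_neq_1:
  assumes "nrm (z - 1) \<ge> 1"
  shows "z ^ (p ^ N) \<noteq> 1"
  using nrm_power_p_power_minus_1[OF assms, of N] by auto

text \<open>
  The classes modulo \<open>p\<^sup>M\<close> inside that of \<open>a\<close> modulo \<open>p\<^sup>N\<close> are those of \<open>a + p\<^sup>N j\<close>, which is the
  indexing in the multiplication formula.
\<close>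

lemma padic_distribution_twisted_bernoulli:
  assumes z: "nrm (z - 1) \<ge> 1" and k: "k \<ge> 1"
  shows "padic_distribution (twisted_bernoulli_distribution k z)"
  unfolding padic_distribution_def
proof (intro allI impI)
  fix N M a assume NM: "N \<le> M" and a: "a < p ^ N"
  have pM: "p ^ M = p ^ N * p ^ (M - N)" using NM by (simp flip: power_add)
  have pos: "p ^ n > 0" for n using p_gt_1 by simp
  have "(\<Sum>b | b < p ^ M \<and> b mod p ^ N = a. twisted_bernoulli_distribution k z b M)
      = (\<Sum>j<p ^ (M - N). twisted_bernoulli_distribution k z (a + p ^ N * j) M)"
  proof (rule sum.reindex_bij_witness[of _ "\<lambda>j. a + p ^ N * j" "\<lambda>b. b div p ^ N"])
    fix b assume b: "b \<in> {b. b < p ^ M \<and> b mod p ^ N = a}"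
    then show "a + p ^ N * (b div p ^ N) = b" by auto
    then show "twisted_bernoulli_distribution k z (a + p ^ N * (b div p ^ N)) M =
        twisted_bernoulli_distribution k z b M" by simp
    show "b div p ^ N \<in> {..<p ^ (M - N)}"
      using b pos by (auto simp: pM less_mult_imp_div_less mult.commute)
  next
    fix j assume "j \<in> {..<p ^ (M - N)}"
    then have "Suc j \<le> p ^ (M - N)" by simp
    then have "p ^ N * Suc j \<le> p ^ M" unfolding pM by (rule mult_le_mono2)
    then show "a + p ^ N * j \<in> {b. b < p ^ M \<and> b mod p ^ N = a}" using a by simp
    show "(a + p ^ N * j) div p ^ N = j" using a p_gt_1 by simp
  qed
  also have "\<dots> = (\<Sum>j<p ^ (M - N). of_nat (p ^ N * p ^ (M - N)) ^ (k - 1) * z ^ (a + p ^ N * j) *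
      twisted_bernoulli k (of_nat (a + p ^ N * j) / of_nat (p ^ N * p ^ (M - N)))
        (z ^ (p ^ N * p ^ (M - N))))"
    unfolding twisted_bernoulli_distribution_def pM[symmetric] by (simp add: power_mult)
  also have "\<dots> = of_nat (p ^ N) ^ (k - 1) * z ^ a * twisted_bernoulli k (of_nat a / of_nat (p ^ N)) (z ^ p ^ N)"
    by (rule twisted_bernoulli_multiplication)
      (use k p_gt_1 power_p_power_neq_1[OF z] in \<open>simp_all flip: pM\<close>)
  also have "\<dots> = twisted_bernoulli_distribution k z a N"
    by (simp add: twisted_bernoulli_distribution_def power_mult)
  finally show "(\<Sum>b | b < p ^ M \<and> b mod p ^ N = a. twisted_bernoulli_distribution k z b M) =
      twisted_bernoulli_distribution k z a N" .
qed

text \<open>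
  Induction along the recurrence.  Since \<open>\<bar>y\<bar> \<le> max (\<bar>y - 1\<bar>) 1 = \<bar>y - 1\<bar>\<close>, the factor \<open>y\<close> in front
  of the lower terms is absorbed by the induction hypothesis for them.
\<close>

lemma nrm_twisted_bernoulli_le:
  assumes "nrm (y - 1) \<ge> 1"
  shows "nrm (y - 1) * nrm (twisted_bernoulli k 0 y) \<le> 1"
proof (induction k rule: less_induct)
  case (less k)
  have y: "nrm y \<le> nrm (y - 1)" using nrm_ultrametric[of "y - 1" 1] assms by simp
  have "y \<noteq> 1" using assms by auto
  define s where "s = (\<Sum>j\<in>{1..k}. y * (of_nat (k choose j) * twisted_bernoulli (k - j) 0 y))"
  have "nrm s \<le> 1"
    unfolding s_def
  proof (rule nrm_sum_le)
    fix j assume "j \<in> {1..k}"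
    then have IH: "nrm (y - 1) * nrm (twisted_bernoulli (k - j) 0 y) \<le> 1" by (intro less) auto
    have "nrm (of_nat (k choose j)) * (nrm y * nrm (twisted_bernoulli (k - j) 0 y)) \<le>
        1 * (nrm (y - 1) * nrm (twisted_bernoulli (k - j) 0 y))"
      by (intro mult_mono nrm_of_nat_le_1 y) auto
    then show "nrm (y * (of_nat (k choose j) * twisted_bernoulli (k - j) 0 y)) \<le> 1"
      using IH by (simp add: nrm_mult mult_ac)
  qed simp
  then have "nrm ((if k = 1 then 1 else 0) - s) \<le> 1"
    using nrm_diff_ultrametric[of "if k = 1 then 1 else 0" s] by (auto split: if_splits)
  then show ?case
    using twisted_bernoulli_recurrence[OF \<open>y \<noteq> 1\<close>, of k]
    by (simp add: s_def sum_distrib_left flip: nrm_mult)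
qed

lemma nrm_power_mult_twisted_bernoulli_le:
  assumes z: "nrm (z - 1) \<ge> 1" and a: "a < p ^ N"
  shows "nrm (z ^ a * twisted_bernoulli k 0 (z ^ (p ^ N))) \<le> 1"
proof -
  have "nrm (z ^ a) * nrm (twisted_bernoulli k 0 (z ^ (p ^ N))) \<le>
      nrm (z ^ (p ^ N) - 1) * nrm (twisted_bernoulli k 0 (z ^ (p ^ N)))"
    using a by (intro mult_right_mono nrm_power_le_nrm_power_minus_1 z) auto
  also have "\<dots> \<le> 1"
    by (rule nrm_twisted_bernoulli_le[OF nrm_power_p_power_minus_1[OF z]])
  finally show ?thesis by (simp add: nrm_mult)
qed

text \<open>
  The polynomial \<open>\<beta>\<^sub>1(x, y)\<close> is constant in \<open>x\<close>, because \<open>\<beta>\<^sub>0 = 0\<close>.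
\<close>

lemma twisted_bernoulli_distribution_1:
  assumes z: "nrm (z - 1) \<ge> 1"
  shows "twisted_bernoulli_distribution 1 z a N = z ^ a * twisted_bernoulli 1 0 (z ^ (p ^ N))"
proof -
  note y = power_p_power_neq_1[OF z, of N]
  have "twisted_bernoulli 1 x (z ^ (p ^ N)) = twisted_bernoulli 1 0 (z ^ (p ^ N))" for x
    using twisted_bernoulli_appell[OF y, of 1 x] by (simp add: twisted_bernoulli_zero[OF y])
  note const_in_x = this
  show ?thesis
    unfolding twisted_bernoulli_distribution_def by (subst const_in_x) simp
qed

text \<open>
  With \<open>Q = p\<^sup>N\<close>, the expansion in powers of \<open>a/Q\<close> has terms
  \<open>(k choose j) a\<^sup>j Q\<^sup>k\<^sup>-\<^sup>1\<^sup>-\<^sup>j z\<^sup>a \<beta>\<^sub>k\<^sub>-\<^sub>j(0, z\<^sup>Q)\<close>.  The term \<open>j = k\<close> vanishes, \<open>j = k - 1\<close> is the main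
  term, and the others are divisible by \<open>Q\<close>.
\<close>

lemma twisted_bernoulli_distribution_congruence:
  assumes z: "nrm (z - 1) \<ge> 1" and k: "k \<ge> 1" and a: "a < p ^ N"
  shows "nrm (twisted_bernoulli_distribution k z a N -
     of_nat k * of_nat a ^ (k - 1) * twisted_bernoulli_distribution 1 z a N) \<le> 1 / real p ^ N"
proof -
  obtain l where l: "k = Suc l" using k by (cases k) auto
  define Q :: 'a where "Q = of_nat p ^ N"
  define B where "B = (\<lambda>i. z ^ a * twisted_bernoulli i 0 (z ^ (p ^ N)))"
  define t where "t = (\<lambda>j. of_nat (k choose j) * of_nat a ^ j * Q ^ (l - j) * B (k - j))"
  note y = power_p_power_neq_1[OF z, of N]
  have Q: "Q \<noteq> 0" using p_gt_1 by (simp add: Q_def)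
  have Ql: "of_nat p ^ (N * (k - 1)) = Q ^ l" by (simp add: Q_def l power_mult)
  have "twisted_bernoulli_distribution k z a N =
      (\<Sum>j\<le>k. Q ^ l * (of_nat (k choose j) * (of_nat a / Q) ^ j * B (k - j)))"
    unfolding twisted_bernoulli_distribution_def twisted_bernoulli_appell[OF y, of k] Ql
      Q_def[symmetric] B_def sum_distrib_left
    by (intro sum.cong refl) (simp only: mult_ac)
  also have "\<dots> = (\<Sum>j\<le>l. Q ^ l * (of_nat (k choose j) * (of_nat a / Q) ^ j * B (k - j)))"
    using y by (simp add: l B_def twisted_bernoulli_zero)
  also have "\<dots> = (\<Sum>j\<le>l. t j)"
  proof (rule sum.cong[OF refl])
    fix j assume "j \<in> {..l}"
    then have "Q ^ l = Q ^ (l - j) * Q ^ j" by (simp flip: power_add)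
    then show "Q ^ l * (of_nat (k choose j) * (of_nat a / Q) ^ j * B (k - j)) = t j"
      using Q by (simp add: t_def power_divide)
  qed
  also have "\<dots> = (\<Sum>j<l. t j) + t l" by (simp flip: lessThan_Suc_atMost)
  also have "t l = of_nat k * of_nat a ^ (k - 1) * twisted_bernoulli_distribution 1 z a N"
    by (simp add: t_def l B_def twisted_bernoulli_distribution_1[OF z, unfolded One_nat_def])
  finally have "twisted_bernoulli_distribution k z a N -
     of_nat k * of_nat a ^ (k - 1) * twisted_bernoulli_distribution 1 z a N = (\<Sum>j<l. t j)" by simp
  also have "nrm \<dots> \<le> 1 / real p ^ N"
  proof (rule nrm_sum_le)
    fix j assume j: "j \<in> {..<l}"
    have eq: "t j = of_nat ((k choose j) * a ^ j * (p ^ N) ^ (l - Suc j)) * B (k - j) * Q"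
      using j by (simp add: t_def Q_def mult_ac flip: power_Suc Suc_diff_Suc)
    have "nrm (t j) \<le> 1 * 1 * (1 / real p ^ N)"
      unfolding eq nrm_mult
      by (intro mult_mono nrm_of_nat_le_1) (auto simp: B_def Q_def nrm_p_power a z
          intro: nrm_power_mult_twisted_bernoulli_le)
    then show "nrm (t j) \<le> 1 / real p ^ N" by simp
  qed simp
  finally show ?thesis .
qed

lemma nrm_twisted_bernoulli_distribution_le_1:
  assumes z: "nrm (z - 1) \<ge> 1" and k: "k \<ge> 1" and a: "a < p ^ N"
  shows "nrm (twisted_bernoulli_distribution k z a N) \<le> 1"
proof -
  let ?c = "of_nat k * of_nat a ^ (k - 1)" and ?m = "twisted_bernoulli_distribution"
  have "nrm (of_nat (k * a ^ (k - 1))) * nrm (?m 1 z a N) \<le> 1 * 1"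
    using nrm_power_mult_twisted_bernoulli_le[OF z a, of 1]
    by (intro mult_mono nrm_of_nat_le_1) (auto simp: twisted_bernoulli_distribution_1[OF z, unfolded One_nat_def])
  then have "nrm (?c * ?m 1 z a N) \<le> 1" by (simp add: nrm_mult)
  moreover have "nrm (?m k z a N - ?c * ?m 1 z a N) \<le> 1"
    using twisted_bernoulli_distribution_congruence[OF assms] inverse_p_le_1[of N] by linarith
  ultimately show ?thesis
    using nrm_ultrametric[of "?m k z a N - ?c * ?m 1 z a N" "?c * ?m 1 z a N"] by simp
qed

text \<open>
  Existence and uniqueness of the measure discharge the definite description.
\<close>

lemma twisted_bernoulli_measure_coset:
  assumes "nrm (z - 1) \<ge> 1" and "k \<ge> 1" and "a < p ^ N"
  shows "twisted_bernoulli_measure p k z (padic_coset p a N) = twisted_bernoulli_distribution k z a N"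
proof -
  have "\<exists>!\<mu>. \<mu> \<in> extensional compact_opens \<and> padic_measure \<mu> \<and>
      (\<forall>N. \<forall>a < p ^ N. \<mu> (padic_coset p a N) = twisted_bernoulli_distribution k z a N)"
    using assms(1,2)
    by (intro ex1_measure_of_distribution padic_distribution_twisted_bernoulli
        nrm_twisted_bernoulli_distribution_le_1)
  from theI'[OF this] show ?thesis
    using assms(3) by (simp add: twisted_bernoulli_measure_def twisted_bernoulli_distribution_def)
qed

lemma riemann_sum_Zp_twisted_bernoulli:
  assumes "nrm (z - 1) \<ge> 1" and "k \<ge> 1"
  shows "riemann_sum_Zp p (twisted_bernoulli_measure p k z) f =
    (\<lambda>N. \<Sum>a | a < p ^ N \<and> True. f (of_nat a) * twisted_bernoulli_distribution k z a N)"
  by (auto simp: fun_eq_iff riemann_sum_Zp_def lessThan_def twisted_bernoulli_measure_coset[OF assms]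
      intro!: sum.cong)

lemma riemann_sum_Zp_units_twisted_bernoulli:
  assumes "nrm (z - 1) \<ge> 1" and "k \<ge> 1"
  shows "riemann_sum_Zp_units p (twisted_bernoulli_measure p k z) f =
    (\<lambda>N. \<Sum>a | a < p ^ N \<and> \<not> p dvd a. f (of_nat a) * twisted_bernoulli_distribution k z a N)"
  by (auto simp: fun_eq_iff riemann_sum_Zp_units_def twisted_bernoulli_measure_coset[OF assms]
      intro!: sum.cong)

section \<open>Integrals of powers\<close>

text \<open>
  Common to all domains and exponents: convergence is established for the first measure and
  carried over to the \<open>k\<close>-th one by the congruence, which also identifies the limit.
\<close>

lemma twisted_bernoulli_riemann_sums_converge:
  assumes z: "nrm (z - 1) \<ge> 1" and k: "k \<ge> 1"
    and P: "\<And>N b. N \<ge> 1 \<Longrightarrow> P b \<longleftrightarrow> P (b mod p ^ N)"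
    and f: "\<And>a. P a \<Longrightarrow> f (of_nat a) = g (of_nat a) * of_nat a ^ (k - 1)"
    and lip: "\<And>a b. P a \<Longrightarrow> P b \<Longrightarrow> nrm (f (of_nat a) - f (of_nat b)) \<le> nrm (of_nat a - of_nat b)"
    and g: "\<And>a. P a \<Longrightarrow> nrm (g (of_nat a)) \<le> 1"
  obtains L where
    "(\<lambda>N. \<Sum>a | a < p ^ N \<and> P a. f (of_nat a) * twisted_bernoulli_distribution 1 z a N) \<longlonglongrightarrow> L"
    "(\<lambda>N. \<Sum>a | a < p ^ N \<and> P a. g (of_nat a) * twisted_bernoulli_distribution k z a N) \<longlonglongrightarrow> of_nat k * L"
proof -
  have "convergent (\<lambda>N. \<Sum>a | a < p ^ N \<and> P a. f (of_nat a) * twisted_bernoulli_distribution 1 z a N)"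
    using z by (intro convergent_riemann_sum padic_distribution_twisted_bernoulli P lip
        nrm_twisted_bernoulli_distribution_le_1) auto
  then obtain L where
    L: "(\<lambda>N. \<Sum>a | a < p ^ N \<and> P a. f (of_nat a) * twisted_bernoulli_distribution 1 z a N) \<longlonglongrightarrow> L"
    by (auto simp: convergent_def)
  then have "(\<lambda>N. \<Sum>a | a < p ^ N \<and> P a.
      g (of_nat a) * of_nat a ^ (k - 1) * twisted_bernoulli_distribution 1 z a N) \<longlonglongrightarrow> L"
    by (simp add: f cong: conj_cong)
  then have "(\<lambda>N. \<Sum>a | a < p ^ N \<and> P a. g (of_nat a) * twisted_bernoulli_distribution k z a N) \<longlonglongrightarrow> of_nat k * L"
    by (rule riemann_sum_comparison)
      (erule twisted_bernoulli_distribution_congruence[OF z k], erule g)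
  with L that show ?thesis by blast
qed

lemma integral_Zp_twisted_bernoulli_measure:
  assumes z: "nrm (z - 1) \<ge> 1" and k: "k \<ge> 1"
  shows "integrable_Zp p (twisted_bernoulli_measure p k z) (\<lambda>x. x ^ r) \<and>
    integrable_Zp p (twisted_bernoulli_measure p 1 z) (\<lambda>x. x ^ (r + k - 1)) \<and>
    integral_Zp p (twisted_bernoulli_measure p k z) (\<lambda>x. x ^ r) =
      of_nat k * integral_Zp p (twisted_bernoulli_measure p 1 z) (\<lambda>x. x ^ (r + k - 1))"
proof -
  have f: "(of_nat a :: 'a) ^ (r + k - 1) = of_nat a ^ r * of_nat a ^ (k - 1)" if True for a
    using k by (simp flip: power_add)
  have lip: "nrm ((of_nat a :: 'a) ^ (r + k - 1) - of_nat b ^ (r + k - 1)) \<le> nrm (of_nat a - of_nat b)"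
    if True True for a b
    by (intro nrm_power_diff_le nrm_of_nat_le_1)
  have g: "nrm (of_nat a ^ r) \<le> 1" if True for a
    by (simp add: nrm_power nrm_of_nat_le_1 power_le_one)
  obtain L where
    "riemann_sum_Zp p (twisted_bernoulli_measure p 1 z) (\<lambda>x. x ^ (r + k - 1)) \<longlonglongrightarrow> L"
    "riemann_sum_Zp p (twisted_bernoulli_measure p k z) (\<lambda>x. x ^ r) \<longlonglongrightarrow> of_nat k * L"
    using twisted_bernoulli_riemann_sums_converge[OF z k, of "\<lambda>_. True" "\<lambda>x. x ^ (r + k - 1)" "\<lambda>x. x ^ r",
        OF refl f lip g] z k
    by (auto simp: riemann_sum_Zp_twisted_bernoulli)
  then show ?thesis
    unfolding integrable_Zp_def integral_Zp_def by (auto simp: convergent_def limI)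
qed

text \<open>
  Negative exponents are harmless because all sample points have norm 1.
\<close>

lemma integral_Zp_units_twisted_bernoulli_measure:
  fixes r :: int
  assumes z: "nrm (z - 1) \<ge> 1" and k: "k \<ge> 1"
  shows "integrable_Zp_units p (twisted_bernoulli_measure p k z) (\<lambda>x. x powi r) \<and>
    integrable_Zp_units p (twisted_bernoulli_measure p 1 z) (\<lambda>x. x powi (r + int k - 1)) \<and>
    integral_Zp_units p (twisted_bernoulli_measure p k z) (\<lambda>x. x powi r) =
      of_nat k * integral_Zp_units p (twisted_bernoulli_measure p 1 z) (\<lambda>x. x powi (r + int k - 1))"
proof -
  have P: "\<not> p dvd b \<longleftrightarrow> \<not> p dvd b mod p ^ N" if "N \<ge> 1" for N b
  proof -
    have "p dvd p ^ N" using that by (simp add: dvd_power)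
    then show ?thesis by (simp add: dvd_mod_iff)
  qed
  have f: "(of_nat a :: 'a) powi (r + int k - 1) = of_nat a powi r * of_nat a ^ (k - 1)"
    if "\<not> p dvd a" for a
  proof -
    have "a \<noteq> 0" using that by (metis dvd_0_right)
    then have "(of_nat a :: 'a) powi (r + int (k - 1)) = of_nat a powi r * of_nat a powi int (k - 1)"
      by (intro power_int_add) auto
    moreover have "r + int (k - 1) = r + int k - 1" using k by simp
    ultimately show ?thesis by (simp only: power_int_of_nat)
  qed
  have lip: "nrm ((of_nat a :: 'a) powi (r + int k - 1) - of_nat b powi (r + int k - 1))
      \<le> nrm (of_nat a - of_nat b)" if "\<not> p dvd a" "\<not> p dvd b" for a b
    using that by (intro nrm_powi_diff_le nrm_of_nat_eq_1)
  have g: "nrm (of_nat a powi r) \<le> 1" if "\<not> p dvd a" for a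
    using that by (simp add: nrm_powi_eq_1 nrm_of_nat_eq_1)
  obtain L where
    "riemann_sum_Zp_units p (twisted_bernoulli_measure p 1 z) (\<lambda>x. x powi (r + int k - 1)) \<longlonglongrightarrow> L"
    "riemann_sum_Zp_units p (twisted_bernoulli_measure p k z) (\<lambda>x. x powi r) \<longlonglongrightarrow> of_nat k * L"
    using twisted_bernoulli_riemann_sums_converge[OF z k, of "\<lambda>a. \<not> p dvd a"
        "\<lambda>x. x powi (r + int k - 1)" "\<lambda>x. x powi r", OF P f lip g] z k
    by (auto simp: riemann_sum_Zp_units_twisted_bernoulli)
  then show ?thesis
    unfolding integrable_Zp_units_def integral_Zp_units_def by (auto simp: convergent_def limI)
qed

text \<open>
  All of \<open>\<int>\<^sub>p\<close> is the single residue class modulo \<open>p\<^sup>0\<close>.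
\<close>

lemma twisted_bernoulli_distribution_total:
  assumes z: "nrm (z - 1) \<ge> 1" and k: "k \<ge> 1"
  shows "(\<Sum>a<p ^ N. twisted_bernoulli_distribution k z a N) = twisted_bernoulli k 0 z"
proof -
  have "(\<Sum>b | b < p ^ N \<and> b mod p ^ 0 = 0. twisted_bernoulli_distribution k z b N) =
      twisted_bernoulli_distribution k z 0 0"
    using padic_distribution_twisted_bernoulli[OF assms] unfolding padic_distribution_def
    by (metis le0 power_0 zero_less_one)
  then show ?thesis by (simp add: lessThan_def twisted_bernoulli_distribution_def)
qed

text \<open>
  Multiplication by \<open>p\<close> identifies \<open>\<int>\<^sub>p\<close> with its non-units and lowers the level by one.
\<close>

lemma twisted_bernoulli_distribution_mult_p:
  "twisted_bernoulli_distribution k z (p * b) (Suc N) =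
    of_nat p ^ (k - 1) * twisted_bernoulli_distribution k (z ^ p) b N"
proof -
  have "(of_nat (p * b) :: 'a) / of_nat p ^ Suc N = of_nat b / of_nat p ^ N"
    using p_gt_1 by simp
  moreover have "z ^ (p * b) = (z ^ p) ^ b" "z ^ (p ^ Suc N) = (z ^ p) ^ (p ^ N)"
    by (simp_all only: power_mult power_Suc)
  moreover have "(of_nat p :: 'a) ^ (Suc N * (k - 1)) = of_nat p ^ (k - 1) * of_nat p ^ (N * (k - 1))"
    by (simp add: power_add)
  ultimately show ?thesis by (simp only: twisted_bernoulli_distribution_def mult.assoc)
qed

lemma twisted_bernoulli_distribution_units_total:
  assumes z: "nrm (z - 1) \<ge> 1" and k: "k \<ge> 1"
  shows "(\<Sum>a | a < p ^ Suc N \<and> \<not> p dvd a. twisted_bernoulli_distribution k z a (Suc N)) =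
    twisted_bernoulli k 0 z - of_nat p ^ (k - 1) * twisted_bernoulli k 0 (z ^ p)"
proof -
  let ?m = "twisted_bernoulli_distribution k"
  have "(\<Sum>a | a < p ^ Suc N \<and> p dvd a. ?m z a (Suc N)) = (\<Sum>b<p ^ N. ?m z (p * b) (Suc N))"
    using p_gt_1
    by (intro sum.reindex_bij_witness[of _ "\<lambda>b. p * b" "\<lambda>a. a div p"]) auto
  also have "\<dots> = of_nat p ^ (k - 1) * (\<Sum>b<p ^ N. ?m (z ^ p) b N)"
    by (simp only: twisted_bernoulli_distribution_mult_p sum_distrib_left)
  also have "\<dots> = of_nat p ^ (k - 1) * twisted_bernoulli k 0 (z ^ p)"
    using twisted_bernoulli_distribution_total[OF nrm_power_p_minus_1[OF z] k] by simp
  finally have dvd: "(\<Sum>a | a < p ^ Suc N \<and> p dvd a. ?m z a (Suc N)) =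
      of_nat p ^ (k - 1) * twisted_bernoulli k 0 (z ^ p)" .
  have "{..<p ^ Suc N} = {a. a < p ^ Suc N \<and> p dvd a} \<union> {a. a < p ^ Suc N \<and> \<not> p dvd a}"
    by auto
  then have "(\<Sum>a<p ^ Suc N. ?m z a (Suc N)) =
      (\<Sum>a | a < p ^ Suc N \<and> p dvd a. ?m z a (Suc N)) + (\<Sum>a | a < p ^ Suc N \<and> \<not> p dvd a. ?m z a (Suc N))"
    by (simp only:) (rule sum.union_disjoint, auto)
  then show ?thesis
    unfolding twisted_bernoulli_distribution_total[OF z k] dvd by (simp add: algebra_simps)
qed

lemma integral_Zp_1_twisted_bernoulli_measure:
  assumes z: "nrm (z - 1) \<ge> 1" and k: "k \<ge> 1"
  shows "integral_Zp p (twisted_bernoulli_measure p k z) (\<lambda>x. 1) = twisted_bernoulli k 0 z"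
  unfolding integral_Zp_def riemann_sum_Zp_twisted_bernoulli[OF z k]
  using twisted_bernoulli_distribution_total[OF z k] by (intro limI) (simp add: lessThan_def)

lemma integral_Zp_units_1_twisted_bernoulli_measure:
  assumes z: "nrm (z - 1) \<ge> 1" and k: "k \<ge> 1"
  shows "integral_Zp_units p (twisted_bernoulli_measure p k z) (\<lambda>x. 1) =
    twisted_bernoulli k 0 z - of_nat p ^ (k - 1) * twisted_bernoulli k 0 (z ^ p)"
  unfolding integral_Zp_units_def riemann_sum_Zp_units_twisted_bernoulli[OF z k]
  by (rule limI, rule LIMSEQ_imp_Suc)
    (simp only: mult_1 twisted_bernoulli_distribution_units_total[OF z k] tendsto_const)

end

lemma padic_complex_numbers_imp_padic_normed_field:
  assumes "prime p" "padic_complex_numbers p nrm"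
  shows "padic_normed_field p nrm"
proof -
  interpret padic_complex_numbers p nrm by (rule assms(2))
  show ?thesis
    by unfold_locales (fact assms(1) dist_nrm nrm_mult nrm_ultrametric nrm_p)+
qed

theorem corollary2:
  fixes p :: nat and nrm :: "'a::{field_char_0, complete_space} \<Rightarrow> real" and z :: 'a and k :: nat
  assumes "prime p"
    and "padic_complex_numbers p nrm"
    and "nrm (1 - z) \<ge> 1"
    and "k \<ge> 1"
  defines "\<mu> \<equiv> twisted_bernoulli_measure p"
  shows
    "(integrable_Zp p (\<mu> 1 z) (\<lambda>x. x ^ (k - 1)) \<and> integrable_Zp p (\<mu> k z) (\<lambda>x. 1) \<and>
      of_nat k * integral_Zp p (\<mu> 1 z) (\<lambda>x. x ^ (k - 1)) = integral_Zp p (\<mu> k z) (\<lambda>x. 1) \<and>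
      integral_Zp p (\<mu> k z) (\<lambda>x. 1) = twisted_bernoulli k 0 z)
   \<and> (integrable_Zp_units p (\<mu> 1 z) (\<lambda>x. x ^ (k - 1)) \<and> integrable_Zp_units p (\<mu> k z) (\<lambda>x. 1) \<and>
      of_nat k * integral_Zp_units p (\<mu> 1 z) (\<lambda>x. x ^ (k - 1)) =
        integral_Zp_units p (\<mu> k z) (\<lambda>x. 1) \<and>
      integral_Zp_units p (\<mu> k z) (\<lambda>x. 1) =
        twisted_bernoulli k 0 z - of_nat p ^ (k - 1) * twisted_bernoulli k 0 (z ^ p))
   \<and> (\<forall>r::nat. integrable_Zp p (\<mu> k z) (\<lambda>x. x ^ r) \<and>
        integrable_Zp p (\<mu> 1 z) (\<lambda>x. x ^ (r + k - 1)) \<and>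
        integral_Zp p (\<mu> k z) (\<lambda>x. x ^ r) =
          of_nat k * integral_Zp p (\<mu> 1 z) (\<lambda>x. x ^ (r + k - 1)))
   \<and> (\<forall>r::int. integrable_Zp_units p (\<mu> k z) (\<lambda>x. x powi r) \<and>
        integrable_Zp_units p (\<mu> 1 z) (\<lambda>x. x powi (r + int k - 1)) \<and>
        integral_Zp_units p (\<mu> k z) (\<lambda>x. x powi r) =
          of_nat k * integral_Zp_units p (\<mu> 1 z) (\<lambda>x. x powi (r + int k - 1)))"
proof -
  interpret padic_normed_field p nrm
    using assms(1,2) by (rule padic_complex_numbers_imp_padic_normed_field)
  have z: "nrm (z - 1) \<ge> 1" using assms(3) by (simp add: nrm_diff_commute)
  have k: "k \<ge> 1" by fact
  note whole = integral_Zp_twisted_bernoulli_measure[OF z k]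
    and units = integral_Zp_units_twisted_bernoulli_measure[OF z k]
  have powi: "(x :: 'a) powi (0 + int k - 1) = x ^ (k - 1)" for x
    using k by (simp add: power_int_of_nat[symmetric] of_nat_diff)
  have "integrable_Zp p (\<mu> 1 z) (\<lambda>x. x ^ (k - 1)) \<and> integrable_Zp p (\<mu> k z) (\<lambda>x. 1) \<and>
      of_nat k * integral_Zp p (\<mu> 1 z) (\<lambda>x. x ^ (k - 1)) = integral_Zp p (\<mu> k z) (\<lambda>x. 1) \<and>
      integral_Zp p (\<mu> k z) (\<lambda>x. 1) = twisted_bernoulli k 0 z"
    using whole[of 0] integral_Zp_1_twisted_bernoulli_measure[OF z k] unfolding \<mu>_def by simp
  moreover have "integrable_Zp_units p (\<mu> 1 z) (\<lambda>x. x ^ (k - 1)) \<and>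
      integrable_Zp_units p (\<mu> k z) (\<lambda>x. 1) \<and>
      of_nat k * integral_Zp_units p (\<mu> 1 z) (\<lambda>x. x ^ (k - 1)) =
        integral_Zp_units p (\<mu> k z) (\<lambda>x. 1) \<and>
      integral_Zp_units p (\<mu> k z) (\<lambda>x. 1) =
        twisted_bernoulli k 0 z - of_nat p ^ (k - 1) * twisted_bernoulli k 0 (z ^ p)"
    using units[of 0, unfolded powi] integral_Zp_units_1_twisted_bernoulli_measure[OF z k]
    unfolding \<mu>_def by simp
  ultimately show ?thesis
    unfolding \<mu>_def by (intro conjI[OF _ conjI[OF _ conjI[OF allI[OF whole] allI[OF units]]]])
qed

end
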